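(* Let $n\in\mathbb N$ and $\lambda\in\mathbb T$. Then $\mathrm{Mult}(\mathcal H_{\lambda,n})=\mathcal H_{\lambda,n}\cap\mathrm{Mult}(\mathcal H_{\sigma,n-1})$.
   Context: $\mathbb D$ open unit disc, $\mathbb T$ unit circle, $dA$ normalized area measure on $\mathbb D$. For $\lambda\in\mathbb T$, $D_{\lambda,n}(f)=\frac{1}{n!(n-1)!}\int_{\mathbb D}|f^{(n)}(z)|^2\frac{1-|z|^2}{|z-\lambda|^2}(1-|z|^2)^{n-1}dA(z)$ and $\mathcal H_{\lambda,n}=\{f\in\mathcal O(\mathbb D):D_{\lambda,n}(f)<\infty\}$. For $f=\sum a_kz^k$ and $j\ge0$, $D_{\sigma,j}(f)=\sum_{k\ge j}\binom kj|a_k|^2$, $\mathcal H_{\sigma,j}=\{f:D_{\sigma,j}(f)<\infty\}$ (so $\mathcal H_{\sigma,0}$ is the Hardy space $H^2$). $\mathrm{Mult}(\mathcal H)=\{\varphi\in\mathcal O(\mathbb D):\varphi f\in\mathcal H\ \forall f\in\mathcal H\}$. *)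

theory Defs
  imports "HOL-Analysis.Analysis"
begin

definition unit_disc :: "complex set" where
  "unit_disc = ball 0 1"

definition Hol_disc :: "(complex \<Rightarrow> complex) set" where
  "Hol_disc = {f. f holomorphic_on unit_disc}"

text \<open>Local Dirichlet-type integral D_{lambda,n}(f), with normalized area measure
  dA = (1/pi) dx dy, as an extended nonnegative real.\<close>
definition D_lambda :: "complex \<Rightarrow> nat \<Rightarrow> (complex \<Rightarrow> complex) \<Rightarrow> ennreal" where
  "D_lambda lam n f =
     ennreal (1 / (fact n * fact (n - 1))) *
     (\<integral>\<^sup>+ z \<in> unit_disc.
        ennreal (cmod ((deriv ^^ n) f z) ^ 2 * ((1 - cmod z ^ 2) / cmod (z - lam) ^ 2)
                 * (1 - cmod z ^ 2) ^ (n - 1) / pi) \<partial>lborel)"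

definition H_lambda :: "complex \<Rightarrow> nat \<Rightarrow> (complex \<Rightarrow> complex) set" where
  "H_lambda lam n = {f \<in> Hol_disc. D_lambda lam n f < \<infinity>}"

definition taylor_coeff :: "(complex \<Rightarrow> complex) \<Rightarrow> nat \<Rightarrow> complex" where
  "taylor_coeff f k = (deriv ^^ k) f 0 / fact k"

definition D_sigma :: "nat \<Rightarrow> (complex \<Rightarrow> complex) \<Rightarrow> ennreal" where
  "D_sigma j f = (\<Sum>k. if j \<le> k then ennreal (real (k choose j) * cmod (taylor_coeff f k) ^ 2) else 0)"

definition H_sigma :: "nat \<Rightarrow> (complex \<Rightarrow> complex) set" where
  "H_sigma j = {f \<in> Hol_disc. D_sigma j f < \<infinity>}"

definition Mult :: "(complex \<Rightarrow> complex) set \<Rightarrow> (complex \<Rightarrow> complex) set" where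
  "Mult H = {\<phi> \<in> Hol_disc. \<forall>f \<in> H. (\<lambda>z. \<phi> z * f z) \<in> H}"

end

theory Submission
  imports Defs "HOL-Complex_Analysis.Complex_Analysis"
begin

text \<open>The key is the local Douglas-type description of the space: \<open>f\<close> lies in
  \<open>H_lambda lam n\<close> iff \<open>f = al + (z - lam) g\<close> on the disc with \<open>g\<close> in \<open>H_sigma (n - 1)\<close>.
  Given this, a multiplier of \<open>H_sigma (n - 1)\<close> of the form \<open>c + (z - lam) q\<close> clearly multiplies
  \<open>H_lambda lam n\<close>. Conversely, if \<open>p\<close> multiplies \<open>H_lambda lam n\<close> then
  \<open>p (z - lam) g = al + (z - lam) h\<close>, and \<open>al = 0\<close> because functions of \<open>H_sigma (n - 1)\<close> grow
  at most like \<open>(1 - r) powr (- 1 / 2)\<close> along the radius to \<open>lam\<close>; hence \<open>p g = h\<close>.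

  For the description itself, the integral is a weighted Bergman norm of
  \<open>F = (deriv ^^ n) f / (z - lam)\<close>, that is, a weighted sum of squares of the Taylor
  coefficients of \<open>F\<close>. With \<open>A k = taylor_coeff f k * lam ^ k\<close>, these have the moduli of
  \<open>\<Sum>i\<le>k. (i + 1) \<dots> (i + n) * A (i + n)\<close>, whereas the coefficients of \<open>(f - al) / (z - lam)\<close>
  have the moduli of \<open>al - (\<Sum>i\<le>k. A i)\<close>. Abel summation expresses either family through the
  other, with remainders controlled by the inequalities of Hardy and of Copson.\<close>

section \<open>Discrete Hardy and Copson inequalities\<close>

text \<open>The bound \<open>2 * u * v \<le> u^2 / 2 + 2 * v^2\<close> absorbs half of the sum of
  the \<open>u^2\<close>. Hardy's and Copson's inequalities, both with constant 4, are thereby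
  reduced to the sign of a sum that telescopes.\<close>

lemma sum_squares_le_of_cross_terms:
  fixes u v :: "nat \<Rightarrow> real"
  assumes "(\<Sum>k<N. (u k)\<^sup>2 - 2 * u k * v k) \<le> 0"
  shows "(\<Sum>k<N. (u k)\<^sup>2) \<le> 4 * (\<Sum>k<N. (v k)\<^sup>2)"
proof -
  have "2 * u k * v k \<le> (u k)\<^sup>2 / 2 + 2 * (v k)\<^sup>2" for k
    using zero_le_power2[of "u k - 2 * v k"] by (simp add: power2_eq_square algebra_simps)
  then have "(u k)\<^sup>2 / 2 - 2 * (v k)\<^sup>2 \<le> (u k)\<^sup>2 - 2 * u k * v k" for k
    by (smt (verit) field_sum_of_halves)
  then have "(\<Sum>k<N. (u k)\<^sup>2 / 2 - 2 * (v k)\<^sup>2) \<le> (\<Sum>k<N. (u k)\<^sup>2 - 2 * u k * v k)"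
    by (intro sum_mono)
  also have "\<dots> \<le> 0" by fact
  finally show ?thesis
    by (simp add: sum_subtractf sum_distrib_left[symmetric] sum_divide_distrib[symmetric])
qed

lemma Hardy_inequality_summable:
  fixes x :: "nat \<Rightarrow> real"
  assumes "summable (\<lambda>k. (x k)\<^sup>2)"
  shows "summable (\<lambda>k. ((\<Sum>i\<le>k. x i) / (real k + 1))\<^sup>2)"
proof (rule summableI_nonneg_bounded)
  define c where "c N = (\<Sum>i<N. x i) / real N" for N
  have cS: "real (Suc N) * c (Suc N) = real N * c N + x N" for N
    by (simp add: c_def field_simps)
  \<comment> \<open>Elliott's telescoping: \<open>x N\<close> is eliminated through the recursion of
    the means \<open>c\<close>, and the square of \<open>c (Suc N) - c N\<close> is dropped.\<close>
  have "(\<Sum>k<N. (c (Suc k))\<^sup>2 - 2 * c (Suc k) * x k) \<le> - real N * (c N)\<^sup>2" for N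
  proof (induction N)
    case (Suc N)
    have x: "x N = real (Suc N) * c (Suc N) - real N * c N" using cS[of N] by simp
    have "(c (Suc N))\<^sup>2 - 2 * c (Suc N) * x N - real N * (c N)\<^sup>2
        = - real (Suc N) * (c (Suc N))\<^sup>2 - real N * (c (Suc N) - c N)\<^sup>2"
      unfolding x by (simp add: power2_eq_square algebra_simps)
    moreover have "0 \<le> real N * (c (Suc N) - c N)\<^sup>2" by simp
    ultimately show ?case using Suc by (simp only: sum.lessThan_Suc)
  qed simp
  then have "(\<Sum>k<N. (c (Suc k))\<^sup>2 - 2 * c (Suc k) * x k) \<le> 0" for N
    using mult_nonneg_nonneg[of "real N" "(c N)\<^sup>2"]
    by (smt (verit) mult_minus_left of_nat_0_le_iff zero_le_power2)
  from sum_squares_le_of_cross_terms[OF this]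
  have "(\<Sum>k<N. ((\<Sum>i\<le>k. x i) / (real k + 1))\<^sup>2) \<le> 4 * (\<Sum>k<N. (x k)\<^sup>2)" for N
    by (simp add: c_def lessThan_Suc_atMost add.commute)
  then show "(\<Sum>k<N. ((\<Sum>i\<le>k. x i) / (real k + 1))\<^sup>2) \<le> 4 * (\<Sum>k. (x k)\<^sup>2)" for N
    by (rule order_trans) (use sum_le_suminf[OF assms, of "{..<N}" for N] in simp)
qed (rule zero_le_power2)

lemma summable_mult_of_summable_squares:
  fixes x y :: "nat \<Rightarrow> real"
  assumes "summable (\<lambda>k. (x k)\<^sup>2)" "summable (\<lambda>k. (y k)\<^sup>2)"
  shows "summable (\<lambda>k. x k * y k)"
proof (rule summable_comparison_test')
  show "summable (\<lambda>k. (x k)\<^sup>2 + (y k)\<^sup>2)" by (intro summable_add assms)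
  fix k
  have "2 * (\<bar>x k\<bar> * \<bar>y k\<bar>) \<le> (x k)\<^sup>2 + (y k)\<^sup>2"
    using sum_squares_bound[of "\<bar>x k\<bar>" "\<bar>y k\<bar>"] by simp
  moreover have "0 \<le> \<bar>x k\<bar> * \<bar>y k\<bar>" by simp
  ultimately show "norm (x k * y k) \<le> (x k)\<^sup>2 + (y k)\<^sup>2"
    unfolding real_norm_def abs_mult by linarith
qed

text \<open>Pairing with the square-summable sequence \<open>1 / (k + 1)\<close>; this makes the
  tails in Copson's inequality convergent series.\<close>

lemma summable_divide_Suc:
  fixes x :: "nat \<Rightarrow> real"
  assumes "summable (\<lambda>k. (x k)\<^sup>2)"
  shows "summable (\<lambda>k. x k / (real k + 1))"
proof -
  have "summable (\<lambda>k. (inverse (real k + 1))\<^sup>2)"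
    using inverse_squares_sums by (simp add: sums_iff power_inverse inverse_eq_divide add.commute power_divide)
  from summable_mult_of_summable_squares[OF assms this] show ?thesis by (simp add: field_simps)
qed

text \<open>The dual of Hardy's inequality: the telescoping runs on tails instead of means. The
  tails are first cut off at \<open>M\<close>; the resulting bound is uniform in \<open>M\<close>
  and passes to the limit.\<close>

lemma Copson_inequality_summable:
  fixes x :: "nat \<Rightarrow> real"
  assumes "summable (\<lambda>k. (x k)\<^sup>2)"
  shows "summable (\<lambda>k. (\<Sum>i. x (i + k) / (real (i + k) + 1))\<^sup>2)"
proof (rule summableI_nonneg_bounded)
  define T where "T M k = (\<Sum>i=k..<M. x i / (real i + 1))" for M k
  have fin: "(\<Sum>k<M. (T M k)\<^sup>2) \<le> 4 * (\<Sum>k<M. (x k)\<^sup>2)" for M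
  proof -
    \<comment> \<open>At \<open>N = M\<close> the right-hand side vanishes, because
      \<open>T M M\<close> is an empty sum.\<close>
    have "(\<Sum>k<N. (T M k)\<^sup>2 - 2 * T M k * x k) \<le> real N * (T M N)\<^sup>2" if "N \<le> M" for N
      using that
    proof (induction N)
      case (Suc N)
      have "T M N = x N / (real N + 1) + T M (Suc N)"
        unfolding T_def using Suc.prems by (intro sum.atLeast_Suc_lessThan) auto
      then have x: "x N = real (Suc N) * (T M N - T M (Suc N))" by (simp add: field_simps)
      have "(T M N)\<^sup>2 - 2 * T M N * x N + real N * (T M N)\<^sup>2
         = real (Suc N) * (T M (Suc N))\<^sup>2 - real (Suc N) * (T M N - T M (Suc N))\<^sup>2"
        unfolding x by (simp add: power2_eq_square algebra_simps)
      moreover have "0 \<le> real (Suc N) * (T M N - T M (Suc N))\<^sup>2" by simp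
      ultimately show ?case using Suc by (simp only: sum.lessThan_Suc) linarith
    qed simp
    from this[of M] show ?thesis by (intro sum_squares_le_of_cross_terms) (simp add: T_def)
  qed
  have lim: "(\<lambda>M. T M k) \<longlonglongrightarrow> (\<Sum>i. x (i + k) / (real (i + k) + 1))" for k
  proof -
    have "summable (\<lambda>i. x (i + k) / (real (i + k) + 1))"
      using summable_ignore_initial_segment[OF summable_divide_Suc[OF assms], of k] by simp
    then have "(\<lambda>M. \<Sum>i<M. x (i + k) / (real (i + k) + 1)) \<longlonglongrightarrow> (\<Sum>i. x (i + k) / (real (i + k) + 1))"
      by (rule summable_LIMSEQ)
    moreover have "(\<Sum>i<M. x (i + k) / (real (i + k) + 1)) = T (M + k) k" for M
      unfolding T_def using sum.shift_bounds_nat_ivl[of "\<lambda>i. x i / (real i + 1)" 0 k M]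
      by (simp add: atLeast0LessThan)
    ultimately show ?thesis by (simp add: LIMSEQ_offset)
  qed
  have bd: "4 * (\<Sum>k<M. (x k)\<^sup>2) \<le> 4 * (\<Sum>k. (x k)\<^sup>2)" for M
    using sum_le_suminf[OF assms, of "{..<M}"] by simp
  show "(\<Sum>k<K. (\<Sum>i. x (i + k) / (real (i + k) + 1))\<^sup>2) \<le> 4 * (\<Sum>k. (x k)\<^sup>2)" for K
  proof (rule LIMSEQ_le_const2)
    show "(\<lambda>M. \<Sum>k<K. (T M k)\<^sup>2) \<longlonglongrightarrow> (\<Sum>k<K. (\<Sum>i. x (i + k) / (real (i + k) + 1))\<^sup>2)"
      by (intro tendsto_sum tendsto_power lim)
    have "(\<Sum>k<K. (T M k)\<^sup>2) \<le> 4 * (\<Sum>k. (x k)\<^sup>2)" if "K \<le> M" for M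
    proof -
      have "(\<Sum>k<K. (T M k)\<^sup>2) \<le> (\<Sum>k<M. (T M k)\<^sup>2)"
        using that by (intro sum_mono2) auto
      then show ?thesis using fin[of M] bd[of M] by linarith
    qed
    then show "\<exists>M0. \<forall>M\<ge>M0. (\<Sum>k<K. (T M k)\<^sup>2) \<le> 4 * (\<Sum>k. (x k)\<^sup>2)" by blast
  qed
qed simp

section \<open>Rising factorials as the common weight\<close>

text \<open>The product \<open>(k + 1) \<dots> (k + m)\<close>. It occurs as the factor that the
  \<open>m\<close>-th derivative puts on Taylor coefficients, as the weight of
  \<open>H_sigma m\<close> up to \<open>fact m\<close>, and, inverted, as the squared Bergman norm
  of a monomial up to a constant.\<close>

definition rising :: "nat \<Rightarrow> nat \<Rightarrow> real" where
  "rising m k = pochhammer (real k + 1) m"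

lemma rising_pos: "0 < rising m k"
  unfolding rising_def by (rule pochhammer_pos) simp

lemma rising_Suc: "rising (Suc m) k = rising m k * (real k + real m + 1)"
  by (simp add: rising_def pochhammer_Suc add_ac)

lemma rising_Suc': "rising (Suc m) k = (real k + 1) * rising m (Suc k)"
  by (simp add: rising_def pochhammer_rec add_ac)

lemma rising_mono: "i \<le> k \<Longrightarrow> rising m i \<le> rising m k"
proof (induction m)
  case (Suc m)
  then show ?case unfolding rising_Suc
    using rising_pos[of m i] by (intro mult_mono) (auto simp: less_imp_le)
qed (simp add: rising_def)

lemma rising_eq_fact: "rising m k = fact (k + m) / fact k"
  by (induction m) (simp_all add: rising_Suc, simp add: rising_def)

lemma rising_eq_binomial: "rising m k = fact m * real ((k + m) choose m)"
  by (simp add: rising_eq_fact binomial_fact add.commute)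

text \<open>The discrete counterpart of differentiating \<open>x ^ (m + 1)\<close>: the increment
  that Abel summation produces when the Bergman coefficients are expressed through
  \<open>g\<close>.\<close>

lemma rising_diff: "rising (Suc m) (Suc k) - rising (Suc m) k = (real m + 1) * rising m (Suc k)"
  unfolding rising_Suc[of m "Suc k"] rising_Suc'[of m k] by (simp add: algebra_simps)

text \<open>The counterpart for negative powers: the coefficients of the tail series when the Abel
  summation is inverted.\<close>

lemma rising_diff_inverse:
  "1 / rising (Suc m) k - 1 / rising (Suc m) (Suc k) = (real m + 1) / rising (Suc (Suc m)) k"
proof -
  have "1 / rising (Suc m) k = (real k + real m + 2) / rising (Suc (Suc m)) k"
    using rising_pos[of "Suc m" k] by (simp add: rising_Suc[of "Suc m"] add_ac divide_simps)
  moreover have "1 / rising (Suc m) (Suc k) = (real k + 1) / rising (Suc (Suc m)) k"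
    using rising_pos[of "Suc m" "Suc k"] by (simp add: rising_Suc'[of "Suc m"] add_ac divide_simps)
  ultimately show ?thesis by (simp add: diff_divide_distrib[symmetric])
qed

text \<open>The weight increases with its argument, and the two additional factors on the right are
  each at least \<open>i + 1\<close>. After taking square roots, this gap of two between the weights
  yields the kernels of Hardy's and Copson's inequalities.\<close>

lemma rising_ratio_le:
  assumes "k \<le> i"
  shows "rising m k * (real i + 1)\<^sup>2 \<le> rising (Suc (Suc m)) i"
proof -
  have "rising m k * (real i + 1)\<^sup>2 \<le> rising m i * ((real i + real m + 1) * (real i + real m + 2))"
    unfolding power2_eq_square using rising_pos[of m i] rising_mono[OF assms, of m]
    by (intro mult_mono) (auto simp: less_imp_le)
  then show ?thesis by (simp add: rising_Suc mult_ac add_ac)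
qed

section \<open>Abel summation between the two weighted coefficient families\<close>

lemma summable_square_abs_add:
  fixes x y :: "nat \<Rightarrow> real"
  assumes "summable (\<lambda>k. (x k)\<^sup>2)" "summable (\<lambda>k. (y k)\<^sup>2)" "\<And>k. \<bar>z k\<bar> \<le> \<bar>x k\<bar> + \<bar>y k\<bar>"
  shows "summable (\<lambda>k. (z k :: real)\<^sup>2)"
proof (rule summable_comparison_test')
  show "summable (\<lambda>k. 2 * (x k)\<^sup>2 + 2 * (y k)\<^sup>2)" by (intro summable_add summable_mult assms)
  fix k
  have "(z k)\<^sup>2 \<le> (\<bar>x k\<bar> + \<bar>y k\<bar>)\<^sup>2" using assms(3)[of k] by (metis abs_ge_zero abs_le_square_iff abs_of_nonneg add_nonneg_nonneg)
  also have "\<dots> \<le> 2 * (x k)\<^sup>2 + 2 * (y k)\<^sup>2"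
    using sum_squares_bound[of "\<bar>x k\<bar>" "\<bar>y k\<bar>"] by (simp add: power2_sum)
  finally show "norm ((z k)\<^sup>2) \<le> 2 * (x k)\<^sup>2 + 2 * (y k)\<^sup>2" by simp
qed

text \<open>\<open>B\<close> is the form that Abel summation gives to the Bergman coefficients.
  After scaling by square roots of the weights, its first term is bounded by a shift of
  \<open>x\<close> and its second by a multiple of the Hardy means of \<open>x\<close>.\<close>

lemma summable_weighted_of_differences:
  fixes g :: "nat \<Rightarrow> complex"
  assumes g: "summable (\<lambda>k. rising m k * (cmod (g k))\<^sup>2)"
    and B: "\<And>k. B k = of_real (rising (Suc m) k) * g (Suc k) - (\<Sum>i\<le>k. of_real ((real m + 1) * rising m i) * g i)"
  shows "summable (\<lambda>k. (cmod (B k))\<^sup>2 / rising (Suc (Suc m)) k)"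
proof -
  define x where "x k = sqrt (rising m k) * cmod (g k)" for k
  have x2: "(x k)\<^sup>2 = rising m k * (cmod (g k))\<^sup>2" and x0: "0 \<le> x k" for k
    using rising_pos[of m k] by (simp_all add: x_def power_mult_distrib less_imp_le)
  have sx: "summable (\<lambda>k. (x k)\<^sup>2)" using g by (simp add: x2)
  have sx': "summable (\<lambda>k. (x (Suc k))\<^sup>2)" using sx by (subst summable_Suc_iff)
  have "summable (\<lambda>k. (real m + 1)\<^sup>2 * ((\<Sum>i\<le>k. x i) / (real k + 1))\<^sup>2)"
    by (intro summable_mult Hardy_inequality_summable sx)
  then have sy: "summable (\<lambda>k. ((real m + 1) * ((\<Sum>i\<le>k. x i) / (real k + 1)))\<^sup>2)"
    by (simp only: power_mult_distrib)
  have "\<bar>cmod (B k) / sqrt (rising (Suc (Suc m)) k)\<bar> \<le> \<bar>x (Suc k)\<bar> + \<bar>(real m + 1) * ((\<Sum>i\<le>k. x i) / (real k + 1))\<bar>" for k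
  proof -
    define R where "R = sqrt (rising (Suc (Suc m)) k)"
    have R: "R > 0" using rising_pos by (simp add: R_def)
    have 1: "rising (Suc m) k * cmod (g (Suc k)) \<le> R * x (Suc k)"
    proof -
      \<comment> \<open>One of the two factors \<open>rising (Suc m) k\<close> under the root is
        split at its lower end; raising \<open>k + 1\<close> to \<open>k + m + 2\<close> completes
        the other one to \<open>rising (Suc (Suc m)) k\<close>.\<close>
      have "rising (Suc m) k = sqrt (rising (Suc m) k * ((real k + 1) * rising m (Suc k)))"
        using rising_pos[of "Suc m" k] by (simp add: rising_Suc'[symmetric])
      also have "\<dots> \<le> sqrt (rising (Suc m) k * ((real k + real m + 2) * rising m (Suc k)))"
        using rising_pos[of "Suc m" k] rising_pos[of m "Suc k"]
        by (intro real_sqrt_le_mono mult_left_mono mult_right_mono) (auto simp: less_imp_le)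
      also have "\<dots> = R * sqrt (rising m (Suc k))"
        by (simp add: R_def real_sqrt_mult[symmetric] rising_Suc[of "Suc m" k] mult_ac add_ac)
      finally show ?thesis
        using mult_right_mono[of "rising (Suc m) k" "R * sqrt (rising m (Suc k))" "cmod (g (Suc k))"]
        by (simp add: x_def mult_ac)
    qed
    \<comment> \<open>The denominator is \<open>k + 1\<close> for every \<open>i \<le> k\<close>, so
      summation over \<open>i\<close> gives exactly the mean that Hardy's inequality
      controls.\<close>
    have 2: "rising m i * cmod (g i) \<le> R * (x i / (real k + 1))" if "i \<le> k" for i
    proof -
      have "rising m i * (real k + 1)\<^sup>2 \<le> rising (Suc (Suc m)) k" by (rule rising_ratio_le[OF that])
      then have "sqrt (rising m i * (real k + 1)\<^sup>2) \<le> R" unfolding R_def by (rule real_sqrt_le_mono)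
      then have "sqrt (rising m i) * (real k + 1) \<le> R" by (simp add: real_sqrt_mult)
      then have "sqrt (rising m i) \<le> R / (real k + 1)" by (simp add: field_simps)
      then have "x i * sqrt (rising m i) \<le> x i * (R / (real k + 1))"
        by (rule mult_left_mono) (rule x0)
      moreover have "x i * sqrt (rising m i) = rising m i * cmod (g i)"
        using rising_pos[of m i] by (simp add: x_def mult_ac)
      ultimately show ?thesis by (simp add: mult_ac)
    qed
    have "cmod (B k) \<le> rising (Suc m) k * cmod (g (Suc k)) + (\<Sum>i\<le>k. (real m + 1) * (rising m i * cmod (g i)))"
      unfolding B using rising_pos
      by (intro order_trans[OF norm_triangle_ineq4] add_mono order_trans[OF norm_sum] sum_mono)
        (auto simp: norm_mult less_imp_le mult_ac simp del: of_real_mult of_real_add)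
    also have "\<dots> \<le> R * x (Suc k) + (\<Sum>i\<le>k. (real m + 1) * (R * (x i / (real k + 1))))"
      using 1 2 by (intro add_mono sum_mono mult_left_mono) auto
    also have "\<dots> = R * (x (Suc k) + (real m + 1) * ((\<Sum>i\<le>k. x i) / (real k + 1)))"
      by (simp only: sum_distrib_left[symmetric] sum_divide_distrib[symmetric] distrib_left mult_ac)
    finally have "cmod (B k) / R \<le> x (Suc k) + (real m + 1) * ((\<Sum>i\<le>k. x i) / (real k + 1))"
      using R by (simp add: divide_le_eq mult.commute)
    moreover have "\<bar>cmod (B k) / R\<bar> = cmod (B k) / R" using R by simp
    ultimately show ?thesis unfolding R_def by linarith
  qed
  from summable_square_abs_add[OF sx' sy this]
  have "summable (\<lambda>k. (cmod (B k) / sqrt (rising (Suc (Suc m)) k))\<^sup>2)" .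
  moreover have "(cmod (B k) / sqrt (rising (Suc (Suc m)) k))\<^sup>2 = (cmod (B k))\<^sup>2 / rising (Suc (Suc m)) k" for k
    using rising_pos[of "Suc (Suc m)" k] by (simp add: power_divide less_imp_le)
  ultimately show ?thesis by simp
qed

text \<open>The converse estimate, by Copson's inequality for the tails of \<open>u\<close>. Values
  of \<open>g\<close> are prescribed at successors, since \<open>g 0\<close> does not influence
  summability.\<close>

lemma summable_weighted_of_tail_sums:
  fixes B :: "nat \<Rightarrow> complex"
  assumes B: "summable (\<lambda>k. (cmod (B k))\<^sup>2 / rising (Suc (Suc m)) k)"
  defines "u \<equiv> \<lambda>i. of_real ((real m + 1) / rising (Suc (Suc m)) i) * B i"
  shows "summable u"
    and "\<And>g. (\<And>k. g (Suc k) = B k / of_real (rising (Suc m) (Suc k)) - (\<Sum>i. u (i + Suc k)))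
      \<Longrightarrow> summable (\<lambda>k. rising m k * (cmod (g k))\<^sup>2)"
proof -
  define x where "x k = cmod (B k) / sqrt (rising (Suc (Suc m)) k)" for k
  have x0: "0 \<le> x k" for k using rising_pos by (simp add: x_def less_imp_le)
  have "(x k)\<^sup>2 = (cmod (B k))\<^sup>2 / rising (Suc (Suc m)) k" for k
    using rising_pos[of "Suc (Suc m)" k] by (simp add: x_def power_divide less_imp_le)
  then have sx: "summable (\<lambda>k. (x k)\<^sup>2)" using B by simp
  have u: "cmod (u i) = (real m + 1) * (x i / sqrt (rising (Suc (Suc m)) i))" for i
    using rising_pos[of "Suc (Suc m)" i]
    by (simp add: u_def x_def norm_mult norm_divide less_imp_le del: of_real_add of_real_divide)
  \<comment> \<open>The case \<open>k = 0\<close> yields absolute convergence of \<open>u\<close>;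
    the general case turns tails of \<open>u\<close> into Copson tails of \<open>x\<close>.\<close>
  have key: "sqrt (rising m k) * cmod (u i) \<le> (real m + 1) * (x i / (real i + 1))" if "k \<le> i" for i k
  proof -
    have "sqrt (rising m k * (real i + 1)\<^sup>2) \<le> sqrt (rising (Suc (Suc m)) i)"
      by (rule real_sqrt_le_mono) (rule rising_ratio_le[OF that])
    then have "sqrt (rising m k) / sqrt (rising (Suc (Suc m)) i) \<le> 1 / (real i + 1)"
      using rising_pos[of "Suc (Suc m)" i] by (simp add: real_sqrt_mult field_simps)
    from mult_left_mono[OF this, of "(real m + 1) * x i"] show ?thesis
      by (simp add: u x0 mult_ac)
  qed
  have sd: "summable (\<lambda>i. (real m + 1) * (x i / (real i + 1)))"
    by (intro summable_mult summable_divide_Suc sx)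
  have su: "summable (\<lambda>i. cmod (u i))"
  proof (rule summable_comparison_test'[where N = 0])
    show "summable (\<lambda>i. (real m + 1) * (x i / (real i + 1)) / sqrt (rising m 0))" by (intro summable_divide sd)
    show "norm (cmod (u i)) \<le> (real m + 1) * (x i / (real i + 1)) / sqrt (rising m 0)" for i
      using key[of 0 i] rising_pos[of m 0] by (simp add: pos_le_divide_eq mult_ac del: times_divide_eq_right)
  qed
  then show "summable u" by (rule summable_norm_cancel)
  fix g
  assume g: "g (Suc k) = B k / of_real (rising (Suc m) (Suc k)) - (\<Sum>i. u (i + Suc k))" for k
  define y where "y k = (\<Sum>i. x (i + k) / (real (i + k) + 1))" for k
  have "summable (\<lambda>k. (real m + 1)\<^sup>2 * (y (Suc k))\<^sup>2)"
    using Copson_inequality_summable[OF sx] unfolding y_def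
    by (intro summable_mult) (subst summable_Suc_iff)
  then have sy: "summable (\<lambda>k. ((real m + 1) * y (Suc k))\<^sup>2)"
    by (simp only: power_mult_distrib)
  have "\<bar>sqrt (rising m (Suc k)) * cmod (g (Suc k))\<bar> \<le> \<bar>x k\<bar> + \<bar>(real m + 1) * y (Suc k)\<bar>" for k
  proof -
    have 1: "sqrt (rising m (Suc k)) * (cmod (B k) / rising (Suc m) (Suc k)) \<le> x k"
    proof -
      \<comment> \<open>The middle weight is at least the geometric mean of its neighbours, because
        its top factor \<open>k + m + 2\<close> is at least \<open>k + 1\<close>.\<close>
      have "rising m (Suc k) * rising (Suc (Suc m)) k \<le> (rising (Suc m) (Suc k))\<^sup>2"
      proof -
        have "rising m (Suc k) * (real k + 1) \<le> rising m (Suc k) * (real k + real m + 2)"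
          using rising_pos[of m "Suc k"] by (intro mult_left_mono) (auto simp: less_imp_le)
        also have "\<dots> = rising (Suc m) (Suc k)" by (simp add: rising_Suc add_ac)
        finally have "rising m (Suc k) * (real k + 1) * rising (Suc m) (Suc k) \<le> rising (Suc m) (Suc k) * rising (Suc m) (Suc k)"
          using rising_pos[of "Suc m" "Suc k"] by (intro mult_right_mono) (auto simp: less_imp_le)
        then show ?thesis unfolding rising_Suc'[of "Suc m" k] power2_eq_square by (simp add: mult_ac)
      qed
      then have "sqrt (rising m (Suc k) * rising (Suc (Suc m)) k) \<le> rising (Suc m) (Suc k)"
        using rising_pos[of "Suc m" "Suc k"] by (intro real_le_lsqrt) (auto simp: less_imp_le)
      then have "sqrt (rising m (Suc k)) / rising (Suc m) (Suc k) \<le> 1 / sqrt (rising (Suc (Suc m)) k)"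
        using rising_pos[of "Suc m" "Suc k"] rising_pos[of "Suc (Suc m)" k]
        by (simp add: real_sqrt_mult field_simps)
      from mult_left_mono[OF this, of "cmod (B k)"] show ?thesis by (simp add: x_def mult_ac)
    qed
    have sk: "summable (\<lambda>i. cmod (u (i + Suc k)))" using su by (subst summable_iff_shift)
    have sdk: "summable (\<lambda>i. (real m + 1) * (x (i + Suc k) / (real (i + Suc k) + 1)))"
      using summable_ignore_initial_segment[OF sd, of "Suc k"] .
    have sdk': "summable (\<lambda>i. x (i + Suc k) / (real (i + Suc k) + 1))"
      using summable_ignore_initial_segment[OF summable_divide_Suc[OF sx], of "Suc k"] .
    have "sqrt (rising m (Suc k)) * cmod (\<Sum>i. u (i + Suc k)) \<le> sqrt (rising m (Suc k)) * (\<Sum>i. cmod (u (i + Suc k)))"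
      using rising_pos[of m "Suc k"] by (intro mult_left_mono summable_norm sk) (auto simp: less_imp_le)
    also have "\<dots> = (\<Sum>i. sqrt (rising m (Suc k)) * cmod (u (i + Suc k)))"
      by (rule suminf_mult[OF sk, symmetric])
    also have "\<dots> \<le> (\<Sum>i. (real m + 1) * (x (i + Suc k) / (real (i + Suc k) + 1)))"
      by (intro suminf_le summable_mult sk sdk key) simp
    also have "\<dots> = (real m + 1) * y (Suc k)"
      unfolding y_def by (rule suminf_mult[OF sdk'])
    finally have 2: "sqrt (rising m (Suc k)) * cmod (\<Sum>i. u (i + Suc k)) \<le> (real m + 1) * y (Suc k)" .
    have "sqrt (rising m (Suc k)) * cmod (g (Suc k))
        \<le> sqrt (rising m (Suc k)) * (cmod (B k) / rising (Suc m) (Suc k) + cmod (\<Sum>i. u (i + Suc k)))"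
    proof (rule mult_left_mono)
      have "cmod (B k / of_real (rising (Suc m) (Suc k))) = cmod (B k) / rising (Suc m) (Suc k)"
        using rising_pos[of "Suc m" "Suc k"] by (simp add: norm_divide)
      then show "cmod (g (Suc k)) \<le> cmod (B k) / rising (Suc m) (Suc k) + cmod (\<Sum>i. u (i + Suc k))"
        unfolding g by (metis norm_triangle_ineq4)
      show "0 \<le> sqrt (rising m (Suc k))" using rising_pos[of m "Suc k"] by simp
    qed
    moreover have "0 \<le> sqrt (rising m (Suc k)) * cmod (g (Suc k))" using rising_pos[of m "Suc k"] by simp
    ultimately show ?thesis using 1 2 by (simp only: distrib_left)
  qed
  from summable_square_abs_add[OF sx sy this]
  have "summable (\<lambda>k. rising m (Suc k) * (cmod (g (Suc k)))\<^sup>2)"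
    using rising_pos by (simp add: power_mult_distrib less_imp_le)
  then show "summable (\<lambda>k. rising m k * (cmod (g k))\<^sup>2)" by (subst (asm) summable_Suc_iff)
qed

text \<open>Applied with \<open>A k = taylor_coeff f k * lam ^ k\<close>, the left side is the
  Bergman condition on the derivative and the right side says that the quotient of
  \<open>f - al\<close> by \<open>z - lam\<close> lies in \<open>H_sigma m\<close>. Abel summation
  in either direction leads to one of the two preceding estimates.\<close>

theorem summable_rising_partial_sums_iff:
  fixes A :: "nat \<Rightarrow> complex"
  shows "summable (\<lambda>k. (cmod (\<Sum>i\<le>k. of_real (rising (Suc m) i) * A (i + Suc m)))\<^sup>2 / rising (Suc (Suc m)) k)
    \<longleftrightarrow> (\<exists>al. summable (\<lambda>k. rising m k * (cmod (al - (\<Sum>i\<le>k + m. A i)))\<^sup>2))"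
proof
  \<comment> \<open>The strict bound gives \<open>D 0 = 0\<close>; the sign makes
    \<open>D k - D (Suc k)\<close> equal to \<open>rising (Suc m) k\<close> times
    \<open>A (k + Suc m)\<close>.\<close>
  define D where "D k = - (\<Sum>i<k. of_real (rising (Suc m) i) * A (i + Suc m))" for k
  assume "summable (\<lambda>k. (cmod (\<Sum>i\<le>k. of_real (rising (Suc m) i) * A (i + Suc m)))\<^sup>2 / rising (Suc (Suc m)) k)"
  then have B: "summable (\<lambda>k. (cmod (D (Suc k)))\<^sup>2 / rising (Suc (Suc m)) k)"
    by (simp add: D_def lessThan_Suc_atMost del: sum.lessThan_Suc)
  define u where "u i = of_real ((real m + 1) / rising (Suc (Suc m)) i) * D (Suc i)" for i
  have su: "summable u" using summable_weighted_of_tail_sums(1)[OF B] unfolding u_def .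
  \<comment> \<open>This is the tail of the series of \<open>A (i + Suc m)\<close> from
    \<open>i = k\<close> on, formally summed by parts. Convergence of the series of \<open>u\<close>
    gives it a meaning.\<close>
  define g where "g k = D k / of_real (rising (Suc m) k) - (\<Sum>i. u (i + k))" for k
  have sg: "summable (\<lambda>k. rising m k * (cmod (g k))\<^sup>2)"
    by (rule summable_weighted_of_tail_sums(2)[OF B]) (simp add: g_def u_def)
  have gS: "g (Suc k) = g k - A (k + Suc m)" for k
  proof -
    have r0: "of_real (rising (Suc m) k) \<noteq> (0::complex)" "of_real (rising (Suc m) (Suc k)) \<noteq> (0::complex)"
      using rising_pos[of "Suc m" k] rising_pos[of "Suc m" "Suc k"] by auto
    have "(\<Sum>i. u (i + k)) = u k + (\<Sum>i. u (i + Suc k))"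
      using suminf_split_head[OF summable_ignore_initial_segment[OF su, of k]] by simp
    moreover have "u k = D (Suc k) * (1 / of_real (rising (Suc m) k) - 1 / of_real (rising (Suc m) (Suc k)))"
    proof -
      have "complex_of_real ((real m + 1) / rising (Suc (Suc m)) k) = 1 / of_real (rising (Suc m) k) - 1 / of_real (rising (Suc m) (Suc k))"
        unfolding rising_diff_inverse[symmetric] by simp
      then show ?thesis by (simp add: u_def)
    qed
    moreover have "D (Suc k) = D k - of_real (rising (Suc m) k) * A (k + Suc m)"
      by (simp add: D_def)
    ultimately show ?thesis
      using r0 unfolding g_def by (simp only: diff_divide_distrib) (simp add: algebra_simps diff_divide_distrib)
  qed
  \<comment> \<open>The value is forced by the case \<open>k = 0\<close>; the recursion
    \<open>gS\<close> extends the identity to all \<open>k\<close>.\<close>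
  define al where "al = g 0 + (\<Sum>i\<le>m. A i)"
  have "al - (\<Sum>i\<le>k + m. A i) = g k" for k
    by (induction k) (simp_all add: al_def gS add_diff_eq)
  then show "\<exists>al. summable (\<lambda>k. rising m k * (cmod (al - (\<Sum>i\<le>k + m. A i)))\<^sup>2)"
    using sg by (intro exI[of _ al]) simp
next
  assume "\<exists>al. summable (\<lambda>k. rising m k * (cmod (al - (\<Sum>i\<le>k + m. A i)))\<^sup>2)"
  then obtain al where al: "summable (\<lambda>k. rising m k * (cmod (al - (\<Sum>i\<le>k + m. A i)))\<^sup>2)" ..
  define g where "g k = al - (\<Sum>i\<le>k + m. A i)" for k
  have A: "A (k + Suc m) = g k - g (Suc k)" for k by (simp add: g_def)
  have "- (\<Sum>i\<le>k. of_real (rising (Suc m) i) * A (i + Suc m))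
    = of_real (rising (Suc m) k) * g (Suc k) - (\<Sum>i\<le>k. of_real ((real m + 1) * rising m i) * g i)" for k
  proof (induction k)
    case 0
    \<comment> \<open>At \<open>k = 0\<close> the boundary term of the summation by parts coincides
      with the term \<open>i = 0\<close> of the sum.\<close>
    have "rising (Suc m) 0 = (real m + 1) * rising m 0" by (simp add: rising_Suc)
    then show ?case by (simp only: A) (simp add: algebra_simps)
  next
    case (Suc k)
    have "complex_of_real (rising (Suc m) (Suc k)) = of_real (rising (Suc m) k) + of_real ((real m + 1) * rising m (Suc k))"
      using rising_diff[of m k] by (metis add.commute diff_add_cancel of_real_add)
    with Suc show ?case by (simp only: A sum.atMost_Suc minus_add_distrib) (simp add: algebra_simps)
  qed
  from summable_weighted_of_differences[OF al[folded g_def] this]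
  show "summable (\<lambda>k. (cmod (\<Sum>i\<le>k. of_real (rising (Suc m) i) * A (i + Suc m)))\<^sup>2 / rising (Suc (Suc m)) k)"
    by simp
qed

section \<open>Weighted Bergman norms of power series\<close>

text \<open>Serves to carry invariance under orthogonal maps from \<open>real^2\<close> to
  \<open>complex\<close>. Agreement with area on boxes suffices, and the preimage of a box is a
  box.\<close>

lemma distr_lborel_complex_of_vec:
  "distr lborel borel (\<lambda>v::real^2. Complex (v$1) (v$2)) = (lborel :: complex measure)"
proof (rule sym, rule lborel_eqI)
  fix l u :: complex
  assume lu: "\<And>b. b \<in> Basis \<Longrightarrow> l \<bullet> b \<le> u \<bullet> b"
  have le: "Re l \<le> Re u" "Im l \<le> Im u"
    using lu[of 1] lu[of \<i>] by (auto simp: Basis_complex_def)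
  have meas: "(\<lambda>v::real^2. Complex (v$1) (v$2)) \<in> borel_measurable borel"
    by (intro borel_measurable_continuous_onI) (auto intro!: continuous_intros simp: Complex_eq)
  have vim: "(\<lambda>v::real^2. Complex (v$1) (v$2)) -` box l u
      = box (vector [Re l, Im l]) (vector [Re u, Im u])"
    by (auto simp: box_def Basis_complex_def Basis_vec_def inner_axis forall_2)
  have "emeasure (distr lborel borel (\<lambda>v::real^2. Complex (v$1) (v$2))) (box l u)
      = emeasure lborel (box (vector [Re l, Im l]) (vector [Re u, Im u] :: real^2))"
    by (subst emeasure_distr) (use meas vim in auto)
  also have "\<dots> = ennreal ((Re u - Re l) * (Im u - Im l))"
    by (subst emeasure_lborel_box) (auto simp: Basis_vec_def inner_axis forall_2 UNIV_2 le prod.insert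
          axis_eq_axis)
  also have "\<dots> = (\<Prod>b\<in>Basis. (u - l) \<bullet> b)"
    by (auto simp: Basis_complex_def)
  finally show "emeasure (distr lborel borel (\<lambda>v::real^2. Complex (v$1) (v$2))) (box l u)
      = ennreal (\<Prod>b\<in>Basis. (u - l) \<bullet> b)" .
qed auto

text \<open>Agreement on boxes suffices. The preimage of a box is its image under the inverse map,
  which is again orthogonal and so keeps Lebesgue measure.\<close>

lemma distr_lborel_orthogonal:
  fixes R :: "real^'n::{finite,wellorder} \<Rightarrow> real^'n::_"
  assumes R: "orthogonal_transformation R"
  shows "distr lborel borel R = lborel"
proof (rule sym, rule lborel_eqI)
  fix l u :: "(real,'n) vec"
  assume lu: "\<And>b. b \<in> Basis \<Longrightarrow> l \<bullet> b \<le> u \<bullet> b"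
  have bl: "bounded_linear R"
    using orthogonal_transformation_linear[OF R] by (simp add: linear_conv_bounded_linear)
  have meas: "R \<in> borel_measurable borel"
    using bl by (intro borel_measurable_continuous_onI linear_continuous_on)
  have bij: "bij R" by (rule orthogonal_transformation_bij[OF R])
  have oi: "orthogonal_transformation (inv R)" by (rule orthogonal_transformation_inv[OF R])
  have vim: "R -` box l u = inv R ` box l u"
    using bij by (simp add: bij_vimage_eq_inv_image)
  have op: "open (R -` box l u)"
    using bl by (intro open_vimage linear_continuous_on) auto
  have lm: "box l u \<in> lmeasurable" by simp
  have "emeasure (distr lborel borel R) (box l u) = emeasure lborel (R -` box l u)"
    by (subst emeasure_distr) (use meas in auto)
  also have "\<dots> = emeasure lebesgue (inv R ` box l u)"
    using op by (simp add: vim)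
  also have "\<dots> = ennreal (measure lebesgue (inv R ` box l u))"
    by (rule emeasure_eq_measure2[OF measurable_orthogonal_image[OF oi lm]])
  also have "\<dots> = ennreal (measure lebesgue (box l u))"
    by (simp only: measure_orthogonal_image[OF oi lm])
  also have "\<dots> = emeasure lborel (box l u)"
    using lu by (simp add: emeasure_eq_ennreal_measure emeasure_lborel_box_eq)
  also have "\<dots> = ennreal (\<Prod>b\<in>Basis. (u - l) \<bullet> b)"
    using lu by (rule emeasure_lborel_box)
  finally show "emeasure (distr lborel borel R) (box l u) = ennreal (\<Prod>b\<in>Basis. (u - l) \<bullet> b)" .
qed auto

text \<open>Seen in \<open>real^2\<close>, multiplication by \<open>c\<close> is linear and
  preserves the norm, hence is orthogonal.\<close>

lemma distr_lborel_cmult_unimodular: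
  fixes c :: complex
  assumes c: "cmod c = 1"
  shows "distr lborel borel ((*) c) = lborel"
proof -
  define to where "to = (\<lambda>v::real^2. Complex (v$1) (v$2))"
  define R where "R = (\<lambda>v::real^2. vector [Re (c * to v), Im (c * to v)] :: real^2)"
  have toR: "to (R v) = c * to v" for v by (simp add: R_def to_def complex_eq_iff)
  have nto: "norm (to v) = norm v" for v
    by (simp add: to_def cmod_def norm_vec_def L2_set_def sum_2)
  have "linear R"
    by (rule linearI) (simp_all add: R_def to_def vec_eq_iff forall_2 algebra_simps)
  moreover have "norm (R v) = norm v" for v
    using nto[of "R v"] nto[of v] by (simp add: toR norm_mult c)
  ultimately have R: "orthogonal_transformation R"
    by (simp add: orthogonal_transformation)
  have tom: "to \<in> borel_measurable borel" unfolding to_def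
    by (intro borel_measurable_continuous_onI) (auto intro!: continuous_intros simp: Complex_eq)
  have Rm: "R \<in> borel_measurable borel"
    using \<open>linear R\<close> by (intro borel_measurable_continuous_onI linear_continuous_on)
      (simp add: linear_conv_bounded_linear)
  have "distr lborel borel ((*) c) = distr (distr lborel borel to) borel ((*) c)"
    unfolding to_def distr_lborel_complex_of_vec ..
  also have "\<dots> = distr lborel borel (\<lambda>v. to (R v))"
    by (subst distr_distr) (use tom in \<open>auto simp: o_def toR\<close>)
  also have "\<dots> = distr (distr lborel borel R) borel to"
    by (subst distr_distr) (use tom Rm in \<open>auto simp: o_def\<close>)
  also have "\<dots> = lborel"
    unfolding distr_lborel_orthogonal[OF R] unfolding to_def by (rule distr_lborel_complex_of_vec)
  finally show ?thesis .
qed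

section \<open>Radial integrals over the disc\<close>

lemma emeasure_annulus:
  assumes "0 \<le> x" "x \<le> 1"
  shows "emeasure lborel {z::complex. x < (cmod z)\<^sup>2 \<and> (cmod z)\<^sup>2 < 1} = ennreal (pi * (1 - x))"
proof -
  have c: "measure lborel (cball (0::complex) r) = pi * r\<^sup>2" "measure lborel (ball (0::complex) r) = pi * r\<^sup>2" if "r \<ge> 0" for r
    using that by (simp_all add: content_cball content_ball unit_ball_vol_2)
  have eq: "{z::complex. x < (cmod z)\<^sup>2 \<and> (cmod z)\<^sup>2 < 1} = ball 0 1 - cball 0 (sqrt x)"
  proof (rule set_eqI)
    fix z :: complex
    have "x < (cmod z)\<^sup>2 \<longleftrightarrow> sqrt x < cmod z"
      by (metis norm_ge_zero real_sqrt_less_iff real_sqrt_unique)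
    moreover have "(cmod z)\<^sup>2 < 1 \<longleftrightarrow> cmod z < 1"
      using abs_square_less_1[of "cmod z"] by simp
    ultimately show "z \<in> {z. x < (cmod z)\<^sup>2 \<and> (cmod z)\<^sup>2 < 1} \<longleftrightarrow> z \<in> ball 0 1 - cball 0 (sqrt x)"
      by (simp add: not_le) blast
  qed
  show ?thesis
  proof (cases "x = 1")
    case True
    then have "{z::complex. x < (cmod z)\<^sup>2 \<and> (cmod z)\<^sup>2 < 1} = {}" by auto
    then show ?thesis using True by (simp only:) simp
  next
    case False
    then have "sqrt x < 1" using assms by simp
    then have sub: "cball (0::complex) (sqrt x) \<subseteq> ball 0 1"
      unfolding subset_iff mem_cball mem_ball by (metis order_le_less_trans)
    have "emeasure lborel (ball 0 1 - cball (0::complex) (sqrt x))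
        = emeasure lborel (ball (0::complex) 1) - emeasure lborel (cball (0::complex) (sqrt x))"
      using sub emeasure_lborel_cball_finite[of "0::complex" "sqrt x"]
      by (intro emeasure_Diff) (auto simp: less_top)
    also have "\<dots> = ennreal pi - ennreal (pi * x)"
      using assms c(2)[of 1] c(1)[of "sqrt x"] emeasure_lborel_ball_finite[of "0::complex" 1] emeasure_lborel_cball_finite[of "0::complex" "sqrt x"]
      by (simp add: emeasure_eq_ennreal_measure less_top)
    also have "\<dots> = ennreal (pi * (1 - x))"
      using assms by (subst ennreal_minus) (auto simp: algebra_simps)
    finally show ?thesis by (simp add: eq)
  qed
qed

text \<open>The squared modulus maps area on the disc to \<open>pi\<close> times the uniform measure
  on the unit interval: by the area of annuli, both have the same finite masses on the rays
  \<open>{x<..}\<close>, and these determine a Borel measure.\<close>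

lemma nn_integral_radial:
  fixes h :: "real \<Rightarrow> ennreal"
  assumes h[measurable]: "h \<in> borel_measurable borel"
  shows "(\<integral>\<^sup>+z\<in>ball (0::complex) 1. h ((cmod z)\<^sup>2) \<partial>lborel) = ennreal pi * (\<integral>\<^sup>+t\<in>{0..1}. h t \<partial>lborel)"
proof -
  define M where "M = distr (density lborel (indicator (ball (0::complex) 1))) borel (\<lambda>z. (cmod z)\<^sup>2)"
  define N where "N = density lborel (\<lambda>t::real. ennreal pi * indicator {0..1} t)"
  have em: "emeasure M {x<..} = ennreal (pi * (1 - max 0 (min x 1)))" for x
  proof -
    have *: "(\<lambda>z::complex. (cmod z)\<^sup>2) -` {x<..} = {z. x < (cmod z)\<^sup>2}" by auto
    have [measurable]: "{z::complex. x < (cmod z)\<^sup>2} \<in> sets borel" by measurable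
    have "emeasure M {x<..} = emeasure lborel ({z. x < (cmod z)\<^sup>2} \<inter> ball 0 1)"
    proof -
      have "emeasure M {x<..} = emeasure (density lborel (indicator (ball (0::complex) 1))) {z. x < (cmod z)\<^sup>2}"
        unfolding M_def by (subst emeasure_distr) (simp_all add: *)
      also have "\<dots> = (\<integral>\<^sup>+z. indicator (ball 0 1) z * indicator {z. x < (cmod z)\<^sup>2} z \<partial>lborel)"
        by (rule emeasure_density) (auto intro!: borel_measurable_indicator)
      also have "\<dots> = (\<integral>\<^sup>+z. indicator ({z. x < (cmod z)\<^sup>2} \<inter> ball 0 1) z \<partial>lborel)"
        by (intro nn_integral_cong) (auto split: split_indicator)
      also have "\<dots> = emeasure lborel ({z. x < (cmod z)\<^sup>2} \<inter> ball 0 1)"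
        by (rule nn_integral_indicator) auto
      finally show ?thesis .
    qed
    also have "({z::complex. x < (cmod z)\<^sup>2} \<inter> ball 0 1) = (if x < 0 then ball 0 1 else if x < 1 then {z. x < (cmod z)\<^sup>2 \<and> (cmod z)\<^sup>2 < 1} else {})"
    proof -
      have "(cmod z)\<^sup>2 < 1 \<longleftrightarrow> cmod z < 1" for z
        using abs_square_less_1[of "cmod z"] by simp
      moreover have "x < (cmod z)\<^sup>2" if "x < 0" for z
        using that zero_le_power2[of "cmod z"] by linarith
      moreover have "\<not> x < (cmod z)\<^sup>2" if "\<not> x < 1" "cmod z < 1" for z
        using that abs_square_less_1[of "cmod z"] by simp
      ultimately show ?thesis by auto
    qed
    also have "emeasure lborel \<dots> = ennreal (pi * (1 - max 0 (min x 1)))"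
    proof -
      have "emeasure lborel (ball (0::complex) 1) = ennreal pi"
        using content_ball[of 1 "0::complex"] emeasure_lborel_ball_finite[of "0::complex" 1]
        by (simp add: unit_ball_vol_2 emeasure_eq_ennreal_measure less_top)
      then show ?thesis using emeasure_annulus[of x] by simp
    qed
    finally show ?thesis .
  qed
  have en: "emeasure N {x<..} = ennreal (pi * (1 - max 0 (min x 1)))" for x
  proof -
    have "emeasure N {x<..} = ennreal pi * emeasure lborel ({0..1} \<inter> {x<..})"
      unfolding N_def by (simp add: emeasure_density mult.assoc nn_integral_cmult
         flip: indicator_inter_arith)
    also have "({0..1} \<inter> {x<..}) = (if x < 0 then {0..1} else {x<..1})" by auto
    also have "ennreal pi * emeasure lborel \<dots> = ennreal (pi * (1 - max 0 (min x 1)))"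
      by (auto simp: ennreal_mult'[symmetric] min_def max_def)
    finally show ?thesis .
  qed
  have "M = N"
    by (rule measure_eqI_lessThan) (simp_all add: em en, simp_all add: M_def N_def)
  have "(\<integral>\<^sup>+z\<in>ball (0::complex) 1. h ((cmod z)\<^sup>2) \<partial>lborel) = (\<integral>\<^sup>+t. h t \<partial>M)"
  proof -
    have "(\<integral>\<^sup>+t. h t \<partial>M) = (\<integral>\<^sup>+z. h ((cmod z)\<^sup>2) \<partial>density lborel (indicator (ball (0::complex) 1)))"
      unfolding M_def by (rule nn_integral_distr) auto
    also have "\<dots> = (\<integral>\<^sup>+z. indicator (ball 0 1) z * h ((cmod z)\<^sup>2) \<partial>lborel)"
      by (rule nn_integral_density) (auto intro!: borel_measurable_indicator)
    finally show ?thesis by (simp add: mult.commute)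
  qed
  also have "\<dots> = ennreal pi * (\<integral>\<^sup>+t\<in>{0..1}. h t \<partial>lborel)"
    unfolding \<open>M = N\<close> N_def
    by (subst nn_integral_density, simp, simp, subst nn_integral_cmult[symmetric]) (auto simp: mult_ac)
  finally show ?thesis .
qed

text \<open>With \<open>t\<close> the squared modulus, this is the Beta integral at
  \<open>k + 1\<close> and \<open>n + 1\<close>.\<close>

lemma nn_integral_monomial_disc:
  "(\<integral>\<^sup>+z\<in>ball (0::complex) 1. ennreal ((cmod z)\<^sup>2 ^ k * (1 - (cmod z)\<^sup>2) ^ n / pi) \<partial>lborel)
   = ennreal (fact k * fact n / fact (k + n + 1))"
proof -
  have B: "Beta (real k + 1) (real n + 1) = fact k * fact n / fact (k + n + 1)"
    using Gamma_fact[of k, where 'a=real] Gamma_fact[of n, where 'a=real] Gamma_fact[of "k+n+1", where 'a=real]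
    by (simp add: Beta_def add_ac)
  have "((\<lambda>t::real. t powr (real k + 1 - 1) * (1 - t) powr (real n + 1 - 1)) has_integral Beta (real k + 1) (real n + 1)) {0..1}"
    by (rule has_integral_Beta_real) auto
  \<comment> \<open>\<open>0 powr 0\<close> is 0 whereas \<open>0 ^ 0\<close> is 1, so the endpoints
    are removed before real powers are replaced by natural ones.\<close>
  then have "((\<lambda>t::real. t powr (real k) * (1 - t) powr (real n)) has_integral Beta (real k + 1) (real n + 1)) {0<..<1}"
    by (simp add: has_integral_Icc_iff_Ioo)
  then have "((\<lambda>t::real. t ^ k * (1 - t) ^ n) has_integral Beta (real k + 1) (real n + 1)) {0<..<1}"
    by (rule has_integral_eq[rotated]) (auto simp: powr_realpow)
  then have I: "((\<lambda>t::real. t ^ k * (1 - t) ^ n) has_integral Beta (real k + 1) (real n + 1)) {0..1}"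
    by (simp add: has_integral_Icc_iff_Ioo)
  then have "((\<lambda>t::real. t ^ k * (1 - t) ^ n / pi) has_integral Beta (real k + 1) (real n + 1) / pi) {0..1}"
    by (rule has_integral_divide)
  then have J: "(\<integral>\<^sup>+t\<in>{0..1}. ennreal (t ^ k * (1 - t) ^ n / pi) \<partial>lborel) = ennreal (Beta (real k + 1) (real n + 1) / pi)"
    by (intro nn_integral_has_integral_lebesgue') auto
  show ?thesis
    unfolding B[symmetric]
    by (subst nn_integral_radial[where h = "\<lambda>t. ennreal (t ^ k * (1 - t) ^ n / pi)"])
       (auto simp: J ennreal_mult'[symmetric])
qed

section \<open>Orthogonality of monomials and Parseval's identity\<close>

text \<open>A rotation preserves area and negates the integrand, so the integral equals its own
  negative. If the integrand is not integrable, its integral is 0 by convention.\<close>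

lemma integral_monomial_cball_orthogonal:
  fixes w :: "real \<Rightarrow> real"
  assumes "j \<noteq> k"
  shows "(\<integral>z. indicator (cball 0 r) z *\<^sub>R (of_real (w (cmod z)) * (z ^ j * cnj z ^ k)) \<partial>lborel) = 0"
    (is "integral\<^sup>L _ ?f = 0")
proof (cases "integrable lborel ?f")
  case True
  then have [measurable]: "?f \<in> borel_measurable borel" by simp
  \<comment> \<open>The angle is chosen so that \<open>c ^ j * cnj c ^ k\<close> is
    \<open>cis pi\<close>, that is, \<open>-1\<close>.\<close>
  define c where "c = cis (pi / (real j - real k))"
  have "c ^ j * cnj c ^ k = cis (real j * (pi / (real j - real k)) - real k * (pi / (real j - real k)))"
    by (simp only: c_def cis_cnj Complex.DeMoivre cis_mult mult_minus_right diff_conv_add_uminus)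
  also have "real j * (pi / (real j - real k)) - real k * (pi / (real j - real k)) = pi"
    unfolding left_diff_distrib[symmetric] using assms by simp
  finally have c: "c ^ j * cnj c ^ k = -1" by simp
  have fc: "?f (c * z) = - ?f z" for z
  proof -
    have "(c * z) ^ j * cnj (c * z) ^ k = (c ^ j * cnj c ^ k) * (z ^ j * cnj z ^ k)"
      by (simp add: power_mult_distrib)
    moreover have "cmod (c * z) = cmod z" by (simp add: norm_mult c_def)
    ultimately show ?thesis unfolding c by (simp add: indicator_def)
  qed
  have "integral\<^sup>L lborel ?f = integral\<^sup>L (distr lborel borel ((*) c)) ?f"
    by (subst distr_lborel_cmult_unimodular) (auto simp: c_def)
  also have "\<dots> = (\<integral>z. ?f (c * z) \<partial>lborel)"
    by (rule integral_distr) auto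
  also have "\<dots> = - integral\<^sup>L lborel ?f"
    unfolding fc by (rule integral_minus)
  finally show ?thesis by simp
qed (rule not_integrable_integral_eq)

text \<open>Parseval's identity for polynomials: the double sum is integrated termwise and only the
  diagonal survives. On a closed disc, continuity makes every term integrable.\<close>

lemma integral_polynomial_cball:
  fixes w :: "real \<Rightarrow> real" and b :: "nat \<Rightarrow> complex"
  assumes w: "continuous_on UNIV w"
  shows "(\<integral>z. indicator (cball 0 r) z *\<^sub>R (w (cmod z) * (cmod (\<Sum>k<N. b k * z ^ k))\<^sup>2) \<partial>lborel)
    = (\<Sum>k<N. (cmod (b k))\<^sup>2 * (\<integral>z. indicator (cball (0::complex) r) z *\<^sub>R (w (cmod z) * (cmod z)\<^sup>2 ^ k) \<partial>lborel))"
proof -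
  define e where "e j k z = indicator (cball 0 r) z *\<^sub>R (of_real (w (cmod z)) * (z ^ j * cnj z ^ k) :: complex)" for j k z
  have wc: "continuous_on A (\<lambda>z::complex. w (cmod z))" for A
    by (rule continuous_on_compose2[OF w]) (auto intro!: continuous_intros)
  have int: "integrable lborel (e j k)" for j k
    unfolding e_def by (rule borel_integrable_compact) (auto intro!: continuous_intros wc)
  have diag: "integral\<^sup>L lborel (e k k)
      = of_real (\<integral>z. indicator (cball (0::complex) r) z *\<^sub>R (w (cmod z) * (cmod z)\<^sup>2 ^ k) \<partial>lborel)" for k
  proof -
    have "e k k z = of_real (indicator (cball (0::complex) r) z *\<^sub>R (w (cmod z) * (cmod z)\<^sup>2 ^ k))" for z
    proof -
      have "z ^ k * cnj z ^ k = of_real ((cmod z)\<^sup>2 ^ k)"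
        by (simp only: power_mult_distrib[symmetric] complex_norm_square[symmetric] of_real_power)
      then show ?thesis by (simp add: e_def scaleR_conv_of_real)
    qed
    then have "e k k = (\<lambda>z. of_real (indicator (cball (0::complex) r) z *\<^sub>R (w (cmod z) * (cmod z)\<^sup>2 ^ k)))" ..
    then show ?thesis by (simp only: integral_complex_of_real)
  qed
  have off: "integral\<^sup>L lborel (e j k) = 0" if "j \<noteq> k" for j k
    unfolding e_def by (rule integral_monomial_cball_orthogonal[OF that])
  have expand: "of_real (indicator (cball (0::complex) r) z *\<^sub>R (w (cmod z) * (cmod (\<Sum>k<N. b k * z ^ k))\<^sup>2))
      = (\<Sum>j<N. \<Sum>k<N. b j * cnj (b k) * e j k z)" for z
  proof -
    have "of_real (indicator (cball (0::complex) r) z *\<^sub>R (w (cmod z) * (cmod (\<Sum>k<N. b k * z ^ k))\<^sup>2))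
      = indicator (cball (0::complex) r) z *\<^sub>R (of_real (w (cmod z)) * ((\<Sum>j<N. b j * z ^ j) * cnj (\<Sum>k<N. b k * z ^ k)))"
      unfolding real_scaleR_def of_real_mult complex_norm_square scaleR_conv_of_real by (rule refl)
    also have "\<dots> = indicator (cball (0::complex) r) z *\<^sub>R (of_real (w (cmod z)) * (\<Sum>j<N. \<Sum>k<N. (b j * z ^ j) * cnj (b k * z ^ k)))"
      by (simp only: cnj_sum sum_product)
    also have "\<dots> = (\<Sum>j<N. \<Sum>k<N. b j * cnj (b k) * e j k z)"
      by (simp add: e_def sum_distrib_left scaleR_sum_right mult_ac)
    finally show ?thesis .
  qed
  have "complex_of_real (\<integral>z. indicator (cball 0 r) z *\<^sub>R (w (cmod z) * (cmod (\<Sum>k<N. b k * z ^ k))\<^sup>2) \<partial>lborel)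
    = (\<integral>z. (\<Sum>j<N. \<Sum>k<N. b j * cnj (b k) * e j k z) \<partial>lborel)"
    by (simp only: integral_complex_of_real[symmetric] expand)
  also have "\<dots> = (\<Sum>j<N. \<Sum>k<N. b j * cnj (b k) * integral\<^sup>L lborel (e j k))"
    by (simp add: Bochner_Integration.integral_sum int)
  also have "\<dots> = (\<Sum>j<N. \<Sum>k<N. if k = j then b j * cnj (b j) * integral\<^sup>L lborel (e j j) else 0)"
    by (intro sum.cong refl) (auto simp: off)
  also have "\<dots> = (\<Sum>j<N. b j * cnj (b j) * integral\<^sup>L lborel (e j j))"
    by simp
  also have "\<dots> = of_real (\<Sum>k<N. (cmod (b k))\<^sup>2 * (\<integral>z. indicator (cball (0::complex) r) z *\<^sub>R (w (cmod z) * (cmod z)\<^sup>2 ^ k) \<partial>lborel))"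
    by (simp only: diag complex_norm_square of_real_sum of_real_mult)
  finally show ?thesis by (simp only: of_real_eq_iff)
qed

text \<open>On a disc of radius below 1 the partial sums are bounded by the constant
  \<open>C\<close>, so dominated convergence carries the polynomial identity over to
  \<open>F\<close>.\<close>

lemma nn_integral_power_series_cball:
  fixes b :: "nat \<Rightarrow> complex"
  assumes F: "F holomorphic_on ball 0 1" and sums: "\<And>z. cmod z < 1 \<Longrightarrow> (\<lambda>k. b k * z ^ k) sums F z"
    and r: "0 \<le> r" "r < 1" and w: "continuous_on UNIV w" "\<And>t. 0 \<le> t \<Longrightarrow> t \<le> r \<Longrightarrow> 0 \<le> w t"
  shows "(\<integral>\<^sup>+z\<in>cball 0 r. ennreal (w (cmod z) * (cmod (F z))\<^sup>2) \<partial>lborel)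
    = (\<Sum>k. ennreal ((cmod (b k))\<^sup>2) * (\<integral>\<^sup>+z\<in>cball (0::complex) r. ennreal (w (cmod z) * (cmod z)\<^sup>2 ^ k) \<partial>lborel))"
proof -
  define I where "I g = (\<integral>z. indicator (cball 0 r) z *\<^sub>R g z \<partial>lborel)" for g :: "complex \<Rightarrow> real"
  have wc: "continuous_on A (\<lambda>z::complex. w (cmod z))" for A
    by (rule continuous_on_compose2[OF w(1)]) (auto intro!: continuous_intros)
  have Fc: "continuous_on (cball 0 r) F"
    using F r by (intro holomorphic_on_imp_continuous_on holomorphic_on_subset[OF F]) auto
  have nn: "(\<integral>\<^sup>+z\<in>cball 0 r. ennreal (g z) \<partial>lborel) = ennreal (I g)" "0 \<le> I g"
    if g: "continuous_on (cball 0 r) g" "\<And>z. cmod z \<le> r \<Longrightarrow> 0 \<le> g z" for g :: "complex \<Rightarrow> real"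
  proof -
    have int: "integrable lborel (\<lambda>z. indicator (cball 0 r) z *\<^sub>R g z)"
      using g by (intro borel_integrable_compact) auto
    have "(\<integral>\<^sup>+z\<in>cball 0 r. ennreal (g z) \<partial>lborel) = (\<integral>\<^sup>+z. ennreal (indicator (cball 0 r) z *\<^sub>R g z) \<partial>lborel)"
      by (intro nn_integral_cong) (auto split: split_indicator)
    also have "\<dots> = ennreal (I g)"
      unfolding I_def using g(2) by (intro nn_integral_eq_integral int) (auto split: split_indicator)
    finally show "(\<integral>\<^sup>+z\<in>cball 0 r. ennreal (g z) \<partial>lborel) = ennreal (I g)" .
    show "0 \<le> I g" unfolding I_def using g(2) by (intro integral_nonneg_AE) (auto split: split_indicator)
  qed
  define S where "S N z = (\<Sum>k<N. b k * z ^ k)" for N z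
  \<comment> \<open>Convergence at a point of modulus strictly between \<open>r\<close> and 1 gives
    absolute convergence at radius \<open>r\<close>.\<close>
  have "summable (\<lambda>k. b k * of_real ((1 + r) / 2) ^ k)"
  proof (rule sums_summable[OF sums])
    show "cmod (of_real ((1 + r) / 2)) < 1" unfolding norm_of_real using r by simp
  qed
  then have sm: "summable (\<lambda>k. cmod (b k) * r ^ k)"
  proof -
    have "cmod (of_real r) < cmod (of_real ((1 + r) / 2))" unfolding norm_of_real using r by simp
    from powser_insidea[OF \<open>summable _\<close> this] show ?thesis using r by (simp add: norm_mult norm_power)
  qed
  define C where "C = (\<Sum>k. cmod (b k) * r ^ k)"
  have SC: "cmod (S N z) \<le> C" if "cmod z \<le> r" for N z
  proof -
    have "cmod (S N z) \<le> (\<Sum>k<N. cmod (b k) * r ^ k)"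
      unfolding S_def by (rule sum_norm_le) (auto simp: norm_mult norm_power intro!: mult_left_mono power_mono that)
    also have "\<dots> \<le> C" unfolding C_def by (rule sum_le_suminf[OF sm]) (use r in auto)
    finally show ?thesis .
  qed
  have "(\<lambda>N. I (\<lambda>z. w (cmod z) * (cmod (S N z))\<^sup>2)) \<longlonglongrightarrow> I (\<lambda>z. w (cmod z) * (cmod (F z))\<^sup>2)"
    unfolding I_def
  proof (rule integral_dominated_convergence[where w = "\<lambda>z. indicator (cball 0 r) z *\<^sub>R (w (cmod z) * C\<^sup>2)"])
    show "(\<lambda>z. indicator (cball 0 r) z *\<^sub>R (w (cmod z) * (cmod (F z))\<^sup>2)) \<in> borel_measurable lborel"
      by (intro borel_measurable_integrable borel_integrable_compact) (auto intro!: continuous_intros wc Fc)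
    show "(\<lambda>z. indicator (cball 0 r) z *\<^sub>R (w (cmod z) * (cmod (S N z))\<^sup>2)) \<in> borel_measurable lborel" for N
      by (intro borel_measurable_integrable borel_integrable_compact) (auto simp: S_def intro!: continuous_intros wc)
    show "integrable lborel (\<lambda>z::complex. indicator (cball 0 r) z *\<^sub>R (w (cmod z) * C\<^sup>2))"
      by (intro borel_integrable_compact) (auto intro!: continuous_intros wc)
    show "AE z in lborel. (\<lambda>N. indicator (cball 0 r) z *\<^sub>R (w (cmod z) * (cmod (S N z))\<^sup>2))
        \<longlonglongrightarrow> indicator (cball 0 r) z *\<^sub>R (w (cmod z) * (cmod (F z))\<^sup>2)"
    proof (rule AE_I2)
      fix z :: complex
      have "(\<lambda>N. S N z) \<longlonglongrightarrow> F z" if "cmod z \<le> r"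
        using sums[of z] that r unfolding sums_def S_def by simp
      then show "(\<lambda>N. indicator (cball 0 r) z *\<^sub>R (w (cmod z) * (cmod (S N z))\<^sup>2))
        \<longlonglongrightarrow> indicator (cball 0 r) z *\<^sub>R (w (cmod z) * (cmod (F z))\<^sup>2)"
        by (cases "cmod z \<le> r") (auto intro!: tendsto_intros)
    qed
    show "AE z in lborel. norm (indicator (cball 0 r) z *\<^sub>R (w (cmod z) * (cmod (S N z))\<^sup>2))
        \<le> indicator (cball 0 r) z *\<^sub>R (w (cmod z) * C\<^sup>2)" for N
      by (rule AE_I2) (auto simp: w(2) abs_mult split: split_indicator intro!: mult_left_mono power_mono SC)
  qed
  moreover have "I (\<lambda>z. w (cmod z) * (cmod (S N z))\<^sup>2)
      = (\<Sum>k<N. (cmod (b k))\<^sup>2 * I (\<lambda>z. w (cmod z) * (cmod z)\<^sup>2 ^ k))" for N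
    unfolding I_def S_def by (rule integral_polynomial_cball[OF w(1)])
  ultimately have s: "(\<lambda>k. (cmod (b k))\<^sup>2 * I (\<lambda>z. w (cmod z) * (cmod z)\<^sup>2 ^ k)) sums I (\<lambda>z. w (cmod z) * (cmod (F z))\<^sup>2)"
    by (simp add: sums_def)
  have I0: "0 \<le> I (\<lambda>z. w (cmod z) * (cmod z)\<^sup>2 ^ k)" for k
    by (rule nn(2)) (auto intro!: continuous_intros wc mult_nonneg_nonneg w(2))
  have "(\<integral>\<^sup>+z\<in>cball 0 r. ennreal (w (cmod z) * (cmod (F z))\<^sup>2) \<partial>lborel) = ennreal (I (\<lambda>z. w (cmod z) * (cmod (F z))\<^sup>2))"
    by (rule nn(1)) (auto intro!: continuous_intros wc Fc mult_nonneg_nonneg w(2))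
  also have "\<dots> = (\<Sum>k. ennreal ((cmod (b k))\<^sup>2 * I (\<lambda>z. w (cmod z) * (cmod z)\<^sup>2 ^ k)))"
    by (rule sym, rule suminf_ennreal_eq[OF _ s]) (simp add: I0)
  also have "\<dots> = (\<Sum>k. ennreal ((cmod (b k))\<^sup>2) * (\<integral>\<^sup>+z\<in>cball (0::complex) r. ennreal (w (cmod z) * (cmod z)\<^sup>2 ^ k) \<partial>lborel))"
  proof (rule suminf_cong)
    fix k
    have "(\<integral>\<^sup>+z\<in>cball (0::complex) r. ennreal (w (cmod z) * (cmod z)\<^sup>2 ^ k) \<partial>lborel) = ennreal (I (\<lambda>z. w (cmod z) * (cmod z)\<^sup>2 ^ k))"
      by (rule nn(1)) (auto intro!: continuous_intros wc mult_nonneg_nonneg w(2))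
    then show "ennreal ((cmod (b k))\<^sup>2 * I (\<lambda>z. w (cmod z) * (cmod z)\<^sup>2 ^ k))
      = ennreal ((cmod (b k))\<^sup>2) * (\<integral>\<^sup>+z\<in>cball (0::complex) r. ennreal (w (cmod z) * (cmod z)\<^sup>2 ^ k) \<partial>lborel)"
      by (simp add: ennreal_mult I0)
  qed
  finally show ?thesis .
qed

text \<open>Continuity from below of the measure with density \<open>h\<close>, along closed discs
  exhausting the open one. The density is cut to the disc, since measurability of \<open>h\<close>
  is assumed only there.\<close>

lemma nn_integral_disc_eq_SUP:
  fixes h :: "complex \<Rightarrow> ennreal"
  assumes h: "(\<lambda>z. h z * indicator (ball 0 1) z) \<in> borel_measurable borel"
  shows "(\<integral>\<^sup>+z\<in>ball 0 1. h z \<partial>lborel) = (SUP m. \<integral>\<^sup>+z\<in>cball 0 (1 - 1 / real (Suc m)). h z \<partial>lborel)"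
    and "incseq (\<lambda>m. \<integral>\<^sup>+z\<in>cball 0 (1 - 1 / real (Suc m)). h z \<partial>lborel)"
proof -
  define A where "A m = cball (0::complex) (1 - 1 / real (Suc m))" for m
  have inc: "incseq A"
    unfolding A_def incseq_def by (auto intro!: subset_cball simp: field_simps)
  have Un: "(\<Union>m. A m) = ball 0 1"
  proof (intro equalityI subsetI)
    fix z :: complex assume "z \<in> ball 0 1"
    then have "0 < 1 - cmod z" by simp
    then obtain m where "1 / real (Suc m) < 1 - cmod z" using nat_approx_posE by metis
    then show "z \<in> (\<Union>m. A m)" unfolding A_def by (auto intro!: exI[of _ m])
  next
    fix z :: complex assume "z \<in> (\<Union>m. A m)"
    then obtain m where "cmod z \<le> 1 - 1 / real (Suc m)" by (auto simp: A_def)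
    moreover have "1 / real (Suc m) > 0" by simp
    ultimately show "z \<in> ball 0 1" unfolding mem_ball dist_0_norm by linarith
  qed
  define M where "M = density lborel (\<lambda>z. h z * indicator (ball 0 1) z)"
  have eM: "emeasure M B = (\<integral>\<^sup>+z\<in>B. h z \<partial>lborel)" if "B \<in> sets borel" "B \<subseteq> ball 0 1" for B
    unfolding M_def using h that
    by (subst emeasure_density) (auto intro!: nn_integral_cong split: split_indicator)
  have sub: "A m \<subseteq> ball 0 1" for m using Un by auto
  have "(SUP m. emeasure M (A m)) = emeasure M (\<Union>m. A m)"
    by (rule SUP_emeasure_incseq[OF _ inc]) (auto simp: M_def A_def)
  then show "(\<integral>\<^sup>+z\<in>ball 0 1. h z \<partial>lborel) = (SUP m. \<integral>\<^sup>+z\<in>cball 0 (1 - 1 / real (Suc m)). h z \<partial>lborel)"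
    using sub by (simp only: Un) (simp add: eM A_def)
  have "emeasure M (A m) \<le> emeasure M (A m')" if "m \<le> m'" for m m'
    using inc that by (intro emeasure_mono) (auto simp: incseq_def M_def A_def)
  then show "incseq (\<lambda>m. \<integral>\<^sup>+z\<in>cball 0 (1 - 1 / real (Suc m)). h z \<partial>lborel)"
    using sub by (auto simp: incseq_def eM A_def)
qed

text \<open>The identity on closed discs extends by monotone convergence on both sides, which also
  covers infinite values.\<close>

theorem nn_integral_power_series_disc:
  fixes b :: "nat \<Rightarrow> complex"
  assumes F: "F holomorphic_on ball 0 1" and sums: "\<And>z. cmod z < 1 \<Longrightarrow> (\<lambda>k. b k * z ^ k) sums F z"
  shows "(\<integral>\<^sup>+z\<in>ball 0 1. ennreal ((1 - (cmod z)\<^sup>2) ^ n / pi * (cmod (F z))\<^sup>2) \<partial>lborel)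
    = (\<Sum>k. ennreal ((cmod (b k))\<^sup>2 * (fact k * fact n / fact (k + n + 1))))"
proof -
  define w where "w t = (1 - t\<^sup>2) ^ n / pi" for t :: real
  have wc: "continuous_on UNIV w" unfolding w_def by (auto intro!: continuous_intros)
  have w0: "0 \<le> w t" if "0 \<le> t" "t \<le> 1" for t
    using that by (auto simp: w_def abs_square_le_1)
  define R where "R m = 1 - 1 / real (Suc m)" for m
  have R: "0 \<le> R m" "R m < 1" for m by (auto simp: R_def)
  have wz: "continuous_on A (\<lambda>z::complex. w (cmod z))" for A
    by (rule continuous_on_compose2[OF wc]) (auto intro!: continuous_intros)
  have Fm: "(\<lambda>z. ennreal (w (cmod z) * (cmod (F z))\<^sup>2) * indicator (ball 0 1) z) \<in> borel_measurable borel"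
  proof -
    have "(\<lambda>z. indicator (ball 0 1) z *\<^sub>R (w (cmod z) * (cmod (F z))\<^sup>2)) \<in> borel_measurable borel"
      by (intro borel_measurable_continuous_on_indicator)
        (auto intro!: continuous_intros wz holomorphic_on_imp_continuous_on F)
    then have "(\<lambda>z. ennreal (indicator (ball 0 1) z *\<^sub>R (w (cmod z) * (cmod (F z))\<^sup>2))) \<in> borel_measurable borel"
      by measurable
    also have "(\<lambda>z. ennreal (indicator (ball 0 1) z *\<^sub>R (w (cmod z) * (cmod (F z))\<^sup>2)))
      = (\<lambda>z. ennreal (w (cmod z) * (cmod (F z))\<^sup>2) * indicator (ball 0 1) z)"
      by (auto split: split_indicator)
    finally show ?thesis .
  qed
  have mm: "(\<lambda>z. ennreal (w (cmod z) * (cmod z)\<^sup>2 ^ k) * indicator (ball (0::complex) 1) z) \<in> borel_measurable borel" for k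
    unfolding w_def by (intro borel_measurable_times_ennreal borel_measurable_indicator) auto
  define m where "m k j = (\<integral>\<^sup>+z\<in>cball (0::complex) (R j). ennreal (w (cmod z) * (cmod z)\<^sup>2 ^ k) \<partial>lborel)" for k j
  have "(\<integral>\<^sup>+z\<in>ball 0 1. ennreal (w (cmod z) * (cmod (F z))\<^sup>2) \<partial>lborel)
      = (SUP j. \<integral>\<^sup>+z\<in>cball 0 (R j). ennreal (w (cmod z) * (cmod (F z))\<^sup>2) \<partial>lborel)"
    unfolding R_def by (rule nn_integral_disc_eq_SUP(1)[OF Fm])
  also have "\<dots> = (SUP j. \<Sum>k. ennreal ((cmod (b k))\<^sup>2) * m k j)"
  proof (rule SUP_cong[OF refl])
    fix j
    show "(\<integral>\<^sup>+z\<in>cball 0 (R j). ennreal (w (cmod z) * (cmod (F z))\<^sup>2) \<partial>lborel)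
      = (\<Sum>k. ennreal ((cmod (b k))\<^sup>2) * m k j)"
      unfolding m_def using R[of j] by (intro nn_integral_power_series_cball F sums wc w0) auto
  qed
  \<comment> \<open>The integrals over growing discs increase with \<open>j\<close>, so supremum and
    sum may be interchanged.\<close>
  also have "\<dots> = (\<Sum>k. SUP j. ennreal ((cmod (b k))\<^sup>2) * m k j)"
    by (rule ennreal_suminf_SUP_eq[symmetric])
      (use nn_integral_disc_eq_SUP(2)[OF mm] in \<open>auto simp: incseq_def m_def R_def intro!: mult_left_mono\<close>)
  also have "\<dots> = (\<Sum>k. ennreal ((cmod (b k))\<^sup>2) * (\<integral>\<^sup>+z\<in>ball (0::complex) 1. ennreal (w (cmod z) * (cmod z)\<^sup>2 ^ k) \<partial>lborel))"
    unfolding nn_integral_disc_eq_SUP(1)[OF mm] m_def R_def by (simp only: SUP_mult_left_ennreal)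
  also have "\<dots> = (\<Sum>k. ennreal ((cmod (b k))\<^sup>2 * (fact k * fact n / fact (k + n + 1))))"
  proof (rule suminf_cong)
    fix k
    have "(\<integral>\<^sup>+z\<in>ball (0::complex) 1. ennreal (w (cmod z) * (cmod z)\<^sup>2 ^ k) \<partial>lborel) = ennreal (fact k * fact n / fact (k + n + 1))"
      using nn_integral_monomial_disc[of k n] unfolding w_def by (simp only: mult_ac times_divide_eq_left times_divide_eq_right)
    then show "ennreal ((cmod (b k))\<^sup>2) * (\<integral>\<^sup>+z\<in>ball (0::complex) 1. ennreal (w (cmod z) * (cmod z)\<^sup>2 ^ k) \<partial>lborel)
      = ennreal ((cmod (b k))\<^sup>2 * (fact k * fact n / fact (k + n + 1)))"
      by (simp only: ennreal_mult'[OF zero_le_power2])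
  qed
  finally show ?thesis unfolding w_def .
qed

section \<open>Taylor coefficients and the two scales of spaces\<close>

lemma Hol_disc_iff: "f \<in> Hol_disc \<longleftrightarrow> f holomorphic_on ball 0 1"
  by (simp add: Hol_disc_def unit_disc_def)

lemma taylor_coeff_sums:
  assumes "f holomorphic_on ball 0 1" "cmod z < 1"
  shows "(\<lambda>k. taylor_coeff f k * z ^ k) sums f z"
  using holomorphic_power_series[OF assms(1), of z] assms(2) by (simp add: taylor_coeff_def)

lemma taylor_coeff_eqI:
  assumes "\<And>z. cmod z < 1 \<Longrightarrow> (\<lambda>k. c k * z ^ k) sums f z"
  shows "taylor_coeff f k = c k"
proof -
  have "f has_fps_expansion Abs_fps c"
  proof (rule has_fps_expansionI)
    have "eventually (\<lambda>z::complex. z \<in> ball 0 1) (nhds 0)" by (intro eventually_nhds_in_open) auto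
    then show "\<forall>\<^sub>F u in nhds 0. (\<lambda>n. fps_nth (Abs_fps c) n * u ^ n) sums f u"
      by eventually_elim (use assms in simp)
  qed
  from fps_nth_fps_expansion[OF this, of k] show ?thesis by (simp add: taylor_coeff_def)
qed

lemma taylor_coeff_cong:
  assumes "f holomorphic_on ball 0 1" "\<And>z. cmod z < 1 \<Longrightarrow> f z = g z"
  shows "taylor_coeff g k = taylor_coeff f k"
  by (rule taylor_coeff_eqI) (use taylor_coeff_sums[OF assms(1)] assms(2) in auto)

lemma taylor_coeff_add:
  assumes "f holomorphic_on ball 0 1" "g holomorphic_on ball 0 1"
  shows "taylor_coeff (\<lambda>z. f z + g z) k = taylor_coeff f k + taylor_coeff g k"
  by (rule taylor_coeff_eqI) (simp add: distrib_right sums_add taylor_coeff_sums assms)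

lemma taylor_coeff_cmult:
  assumes "f holomorphic_on ball 0 1"
  shows "taylor_coeff (\<lambda>z. c * f z) k = c * taylor_coeff f k"
  by (rule taylor_coeff_eqI) (simp add: mult.assoc sums_mult taylor_coeff_sums assms)

lemma taylor_coeff_diff_const:
  assumes "f holomorphic_on ball 0 1"
  shows "taylor_coeff (\<lambda>z. f z - al) k = taylor_coeff f k - (if k = 0 then al else 0)"
proof (rule taylor_coeff_eqI)
  fix z :: complex assume z: "cmod z < 1"
  have "(\<lambda>k. if k = 0 then al else 0) sums al" by (rule sums_single)
  from sums_diff[OF taylor_coeff_sums[OF assms z] this]
  show "(\<lambda>k. (taylor_coeff f k - (if k = 0 then al else 0)) * z ^ k) sums (f z - al)"
    by (rule sums_cong[THEN iffD1, rotated]) (simp add: left_diff_distrib)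
qed

lemma taylor_coeff_higher_deriv:
  assumes "f holomorphic_on ball 0 1"
  shows "taylor_coeff ((deriv ^^ n) f) k = of_real (rising n k) * taylor_coeff f (k + n)"
  by (simp add: taylor_coeff_def rising_eq_fact funpow_add[symmetric, THEN fun_cong, simplified o_def])

text \<open>The Cauchy product of the series of \<open>f\<close> with the geometric expansion of
  \<open>1 / (z - lam)\<close>, whose coefficients are \<open>- cnj lam ^ Suc i\<close> because
  \<open>1 / lam = cnj lam\<close>.\<close>

lemma taylor_coeff_divide_linear:
  assumes f: "f holomorphic_on ball 0 1" and lam: "cmod lam = 1"
  shows "taylor_coeff (\<lambda>z. f z / (z - lam)) k = - (\<Sum>i\<le>k. taylor_coeff f i * cnj lam ^ Suc (k - i))"
proof (rule taylor_coeff_eqI)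
  fix z :: complex assume z: "cmod z < 1"
  have l: "lam * cnj lam = 1" using lam by (simp add: complex_norm_square[symmetric])
  have nz: "cmod (cnj lam * z) < 1" using z lam by (simp add: norm_mult)
  define p where "p i = taylor_coeff f i * z ^ i" for i
  define q where "q i = - (cnj lam * (cnj lam * z) ^ i)" for i
  have zl: "z \<noteq> lam" using z lam by auto
  have "summable (\<lambda>i. cmod (p i))"
  proof -
    obtain s where s: "cmod z < s" "s < 1" using dense[OF z] by blast
    then have "0 < s" using norm_ge_zero[of z] by linarith
    have "summable (\<lambda>k. taylor_coeff f k * of_real s ^ k)"
      by (rule sums_summable[OF taylor_coeff_sums[OF f]]) (use s \<open>0 < s\<close> in auto)
    from powser_insidea[OF this, of z] show ?thesis using s \<open>0 < s\<close> by (simp add: p_def)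
  qed
  moreover have "summable (\<lambda>i. cmod (q i))"
    using nz lam by (simp add: q_def norm_mult norm_power summable_geometric)
  ultimately have "(\<lambda>k. \<Sum>i\<le>k. p i * q (k - i)) sums ((\<Sum>k. p k) * (\<Sum>k. q k))"
    by (rule Cauchy_product_sums)
  moreover have "(\<Sum>k. p k) = f z" unfolding p_def by (rule sums_unique[symmetric]) (rule taylor_coeff_sums[OF f z])
  moreover have "(\<Sum>k. q k) = 1 / (z - lam)"
  proof (rule sums_unique[symmetric])
    have "(\<lambda>i. - (cnj lam * (cnj lam * z) ^ i)) sums (- (cnj lam * (1 / (1 - cnj lam * z))))"
      by (intro sums_minus sums_mult geometric_sums nz)
    moreover have "- (cnj lam * (1 / (1 - cnj lam * z))) = 1 / (z - lam)"
    proof -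
      have "1 - cnj lam * z \<noteq> 0" using nz by (metis eq_iff_diff_eq_0 less_irrefl norm_one)
      moreover have "cnj lam * (z - lam) = - (1 - cnj lam * z)" using l by (simp add: algebra_simps)
      ultimately show ?thesis using zl by (simp add: divide_simps)
    qed
    ultimately show "q sums (1 / (z - lam))" by (simp add: q_def[abs_def])
  qed
  moreover have "(\<Sum>i\<le>k. p i * q (k - i)) = - (\<Sum>i\<le>k. taylor_coeff f i * cnj lam ^ Suc (k - i)) * z ^ k" for k
    unfolding sum_negf[symmetric] sum_distrib_right p_def q_def
  proof (rule sum.cong[OF refl])
    fix i assume "i \<in> {..k}"
    then have "z ^ k = z ^ i * z ^ (k - i)" by (simp add: power_add[symmetric])
    then show "taylor_coeff f i * z ^ i * - (cnj lam * (cnj lam * z) ^ (k - i)) = - (taylor_coeff f i * cnj lam ^ Suc (k - i)) * z ^ k"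
      by (simp add: power_mult_distrib)
  qed
  ultimately show "(\<lambda>k. - (\<Sum>i\<le>k. taylor_coeff f i * cnj lam ^ Suc (k - i)) * z ^ k) sums (f z / (z - lam))"
    by simp
qed

text \<open>Multiplication by the unimodular number \<open>lam ^ Suc k\<close> turns the convolution
  into a plain partial sum of twisted coefficients.\<close>

lemma cmod_taylor_coeff_divide_linear:
  assumes f: "f holomorphic_on ball 0 1" and lam: "cmod lam = 1"
  shows "cmod (taylor_coeff (\<lambda>z. f z / (z - lam)) k) = cmod (\<Sum>i\<le>k. taylor_coeff f i * lam ^ i)"
proof -
  have l: "lam * cnj lam = 1" using lam by (simp add: complex_norm_square[symmetric])
  have "lam ^ Suc k * (\<Sum>i\<le>k. taylor_coeff f i * cnj lam ^ Suc (k - i)) = (\<Sum>i\<le>k. taylor_coeff f i * lam ^ i)"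
    unfolding sum_distrib_left
  proof (rule sum.cong[OF refl])
    fix i assume "i \<in> {..k}"
    then have "lam ^ Suc k = lam ^ Suc (k - i) * lam ^ i" by (simp add: power_add[symmetric])
    moreover have "lam ^ Suc (k - i) * cnj lam ^ Suc (k - i) = 1" by (simp only: power_mult_distrib[symmetric] l power_one)
    ultimately show "lam ^ Suc k * (taylor_coeff f i * cnj lam ^ Suc (k - i)) = taylor_coeff f i * lam ^ i"
      by (metis (no_types, lifting) mult.assoc mult.commute mult_1)
  qed
  then have "cmod (\<Sum>i\<le>k. taylor_coeff f i * lam ^ i) = cmod (lam ^ Suc k) * cmod (\<Sum>i\<le>k. taylor_coeff f i * cnj lam ^ Suc (k - i))"
    by (simp only: norm_mult[symmetric])
  then show ?thesis by (simp add: taylor_coeff_divide_linear[OF f lam] norm_power norm_mult lam del: power_Suc)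
qed

section \<open>The spaces \<open>H_sigma\<close> in terms of coefficients\<close>

lemma suminf_ennreal_finite_iff:
  assumes "\<And>k. 0 \<le> c k"
  shows "(\<Sum>k. ennreal (c k)) < \<infinity> \<longleftrightarrow> summable c"
proof
  assume "(\<Sum>k. ennreal (c k)) < \<infinity>"
  then show "summable c" using summable_suminf_not_top[OF assms] by (simp add: less_top)
next
  assume "summable c"
  then show "(\<Sum>k. ennreal (c k)) < \<infinity>" using suminf_ennreal2[OF assms] by simp
qed

text \<open>The binomial coefficient vanishes for \<open>k < m\<close>, which removes the case
  distinction; shifting the index by \<open>m\<close> turns the weight into
  \<open>rising m k / fact m\<close>.\<close>

lemma H_sigma_iff:
  "f \<in> H_sigma m \<longleftrightarrow> f holomorphic_on ball 0 1 \<and> summable (\<lambda>k. rising m k * (cmod (taylor_coeff f (k + m)))\<^sup>2)"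
proof -
  have "D_sigma m f = (\<Sum>k. ennreal (real (k choose m) * cmod (taylor_coeff f k) ^ 2))"
    unfolding D_sigma_def by (intro suminf_cong) (auto simp: binomial_eq_0)
  then have "D_sigma m f < \<infinity> \<longleftrightarrow> summable (\<lambda>k. real (k choose m) * cmod (taylor_coeff f k) ^ 2)"
    by (simp only: suminf_ennreal_finite_iff mult_nonneg_nonneg of_nat_0_le_iff zero_le_power2)
  also have "\<dots> \<longleftrightarrow> summable (\<lambda>k. real ((k + m) choose m) * cmod (taylor_coeff f (k + m)) ^ 2)"
    by (rule summable_iff_shift[symmetric])
  also have "\<dots> \<longleftrightarrow> summable (\<lambda>k. rising m k * (cmod (taylor_coeff f (k + m)))\<^sup>2)"
    by (simp add: rising_eq_binomial mult.assoc summable_cmult_iff)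
  finally show ?thesis by (simp add: H_sigma_def Hol_disc_iff)
qed

lemma H_sigma_cong:
  assumes "f \<in> H_sigma m" "\<And>z. cmod z < 1 \<Longrightarrow> f z = g z"
  shows "g \<in> H_sigma m"
proof -
  have f: "f holomorphic_on ball 0 1" using assms by (simp add: H_sigma_iff)
  have "g holomorphic_on ball 0 1" by (rule holomorphic_transform[OF f]) (use assms in auto)
  then show ?thesis using assms by (simp add: H_sigma_iff taylor_coeff_cong[OF f assms(2)])
qed

lemma H_sigma_cmult:
  assumes "f \<in> H_sigma m"
  shows "(\<lambda>z. c * f z) \<in> H_sigma m"
proof -
  have f: "f holomorphic_on ball 0 1"
    and s: "summable (\<lambda>k. (cmod c)\<^sup>2 * (rising m k * (cmod (taylor_coeff f (k + m)))\<^sup>2))"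
    using assms by (auto simp: H_sigma_iff intro!: summable_mult)
  show ?thesis using s
    by (auto simp: H_sigma_iff taylor_coeff_cmult[OF f] norm_mult power_mult_distrib mult_ac
        intro!: holomorphic_intros f)
qed

lemma H_sigma_add:
  assumes "f \<in> H_sigma m" "g \<in> H_sigma m"
  shows "(\<lambda>z. f z + g z) \<in> H_sigma m"
proof -
  have fg: "f holomorphic_on ball 0 1" "g holomorphic_on ball 0 1" using assms by (auto simp: H_sigma_iff)
  define s where "s h k = sqrt (rising m k) * cmod (taylor_coeff h (k + m))" for h k
  have s: "(s h k)\<^sup>2 = rising m k * (cmod (taylor_coeff h (k + m)))\<^sup>2" for h k
    using rising_pos[of m k] by (simp add: s_def power_mult_distrib less_imp_le)
  have "summable (\<lambda>k. (s (\<lambda>z. f z + g z) k)\<^sup>2)"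
  proof (rule summable_square_abs_add)
    show "summable (\<lambda>k. (s f k)\<^sup>2)" "summable (\<lambda>k. (s g k)\<^sup>2)"
      using assms by (auto simp: H_sigma_iff s)
    show "\<bar>s (\<lambda>z. f z + g z) k\<bar> \<le> \<bar>s f k\<bar> + \<bar>s g k\<bar>" for k
      using rising_pos[of m k]
      by (simp add: s_def abs_mult taylor_coeff_add[OF fg] distrib_left[symmetric] mult_left_mono norm_triangle_ineq)
  qed
  then show ?thesis using fg by (auto simp: H_sigma_iff s intro!: holomorphic_intros)
qed

text \<open>The weights are at least 1, so \<open>h\<close> lies in the Hardy space; Cauchy-Schwarz
  against a geometric series then bounds its growth.\<close>

lemma H_sigma_growth:
  assumes h: "h \<in> H_sigma m"
  obtains C where "\<And>z. cmod z < 1 \<Longrightarrow> (cmod (h z))\<^sup>2 * (1 - cmod z) \<le> C"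
proof -
  have hol: "h holomorphic_on ball 0 1" using h by (simp add: H_sigma_iff)
  have "summable (\<lambda>k. (cmod (taylor_coeff h (k + m)))\<^sup>2)"
  proof (rule summable_comparison_test'[where N = 0])
    show "summable (\<lambda>k. rising m k * (cmod (taylor_coeff h (k + m)))\<^sup>2)" using h by (simp add: H_sigma_iff)
    fix k
    have "1 \<le> rising m k"
      using rising_mono[of 0 k m] by (simp add: rising_eq_fact[of m 0]) (meson fact_ge_1 order_trans)
    then show "norm ((cmod (taylor_coeff h (k + m)))\<^sup>2) \<le> rising m k * (cmod (taylor_coeff h (k + m)))\<^sup>2"
      using mult_right_mono[of 1 "rising m k" "(cmod (taylor_coeff h (k + m)))\<^sup>2"] by simp
  qed
  then have sm: "summable (\<lambda>k. (cmod (taylor_coeff h k))\<^sup>2)" by (subst (asm) summable_iff_shift)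
  define C where "C = (\<Sum>k. (cmod (taylor_coeff h k))\<^sup>2)"
  have "(cmod (h z))\<^sup>2 * (1 - cmod z) \<le> C" if z: "cmod z < 1" for z
  proof (rule LIMSEQ_le_const2)
    show "(\<lambda>N. (cmod (\<Sum>k<N. taylor_coeff h k * z ^ k))\<^sup>2 * (1 - cmod z)) \<longlonglongrightarrow> (cmod (h z))\<^sup>2 * (1 - cmod z)"
      using taylor_coeff_sums[OF hol z] unfolding sums_def by (intro tendsto_intros)
    have "(cmod (\<Sum>k<N. taylor_coeff h k * z ^ k))\<^sup>2 * (1 - cmod z) \<le> C" for N
    proof -
      have "(cmod (\<Sum>k<N. taylor_coeff h k * z ^ k))\<^sup>2 \<le> (\<Sum>k<N. cmod (taylor_coeff h k) * cmod z ^ k)\<^sup>2"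
        by (intro power_mono sum_norm_le) (auto simp: norm_mult norm_power)
      also have "\<dots> \<le> (\<Sum>k<N. (cmod (taylor_coeff h k))\<^sup>2) * (\<Sum>k<N. (cmod z ^ k)\<^sup>2)"
        by (rule Cauchy_Schwarz_ineq_sum)
      also have "\<dots> \<le> C * (1 / (1 - cmod z))"
      proof (rule mult_mono)
        show "(\<Sum>k<N. (cmod (taylor_coeff h k))\<^sup>2) \<le> C"
          unfolding C_def by (rule sum_le_suminf[OF sm]) auto
        then show "0 \<le> C" by (rule order_trans[rotated]) (simp add: sum_nonneg)
        \<comment> \<open>Replacing the square by \<open>cmod z ^ k\<close> gives
          \<open>1 / (1 - cmod z)\<close> directly and costs at most a factor 2.\<close>
        have "(\<Sum>k<N. (cmod z ^ k)\<^sup>2) \<le> (\<Sum>k<N. cmod z ^ k)"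
          using z by (intro sum_mono) (simp add: power2_eq_square mult_left_le power_le_one)
        also have "\<dots> \<le> (\<Sum>k. cmod z ^ k)"
          using z by (intro sum_le_suminf summable_geometric) auto
        also have "\<dots> = 1 / (1 - cmod z)" using z by (intro suminf_geometric) auto
        finally show "(\<Sum>k<N. (cmod z ^ k)\<^sup>2) \<le> 1 / (1 - cmod z)" .
        show "0 \<le> (\<Sum>k<N. (cmod z ^ k)\<^sup>2)" by (simp add: sum_nonneg)
      qed
      finally show ?thesis using z by (simp add: field_simps)
    qed
    then show "\<exists>N. \<forall>n\<ge>N. (cmod (\<Sum>k<n. taylor_coeff h k * z ^ k))\<^sup>2 * (1 - cmod z) \<le> C" by blast
  qed
  then show ?thesis using that by blast
qed

text \<open>On the radius, \<open>z - lam\<close> has modulus \<open>1 - r\<close>, so the growth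
  bound leaves a product of modulus at most \<open>sqrt (C * (1 - r))\<close>.\<close>

lemma H_sigma_radial_limit:
  assumes h: "h \<in> H_sigma m" and lam: "cmod lam = 1"
  shows "((\<lambda>r. (of_real r * lam - lam) * h (of_real r * lam)) \<longlongrightarrow> 0) (at_left 1)"
proof -
  obtain C where C: "\<And>z. cmod z < 1 \<Longrightarrow> (cmod (h z))\<^sup>2 * (1 - cmod z) \<le> C"
    using H_sigma_growth[OF h] by blast
  have ev: "eventually (\<lambda>r::real. 0 < r \<and> r < 1) (at_left 1)"
    using eventually_at_left_real[of 0 1] by simp
  have "((\<lambda>r. sqrt (C * (1 - r))) \<longlongrightarrow> sqrt (C * (1 - 1))) (at_left 1)"
    by (intro tendsto_intros)
  then have lim: "((\<lambda>r. sqrt (C * (1 - r))) \<longlongrightarrow> 0) (at_left 1)" by simp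
  show ?thesis
  proof (rule Lim_null_comparison[OF _ lim])
    show "\<forall>\<^sub>F r in at_left 1. norm ((of_real r * lam - lam) * h (of_real r * lam)) \<le> sqrt (C * (1 - r))"
      using ev
    proof eventually_elim
      case (elim r)
      have nr: "cmod (of_real r * lam) = r" using elim lam by (simp add: norm_mult)
      have "of_real r * lam - lam = - (of_real (1 - r) * lam)" by (simp add: algebra_simps)
      then have n1: "cmod (of_real r * lam - lam) = 1 - r"
        using elim lam by (simp only: norm_minus_cancel norm_mult norm_of_real) simp
      have "(cmod (h (of_real r * lam)))\<^sup>2 * (1 - r) * (1 - r) \<le> C * (1 - r)"
        using C[of "of_real r * lam"] elim by (intro mult_right_mono) (auto simp only: nr)
      then have "(norm ((of_real r * lam - lam) * h (of_real r * lam)))\<^sup>2 \<le> C * (1 - r)"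
        by (simp add: norm_mult n1[unfolded mult.commute[of _ lam]] power_mult_distrib power2_eq_square mult_ac)
      then show ?case by (rule real_le_rsqrt)
    qed
  qed
qed

section \<open>The local Douglas description of \<open>H_lambda\<close>\<close>

text \<open>The numerator of the Poisson kernel raises the exponent of the weight from
  \<open>m\<close> to \<open>Suc m\<close>, and its denominator is absorbed into \<open>F\<close>.
  Up to a positive constant, the integral is thus the square of a weighted Bergman norm of a
  holomorphic function.\<close>

lemma D_lambda_finite_iff:
  assumes f: "f holomorphic_on ball 0 1" and lam: "cmod lam = 1"
  shows "D_lambda lam (Suc m) f < \<infinity> \<longleftrightarrow>
    summable (\<lambda>k. (cmod (taylor_coeff (\<lambda>z. (deriv ^^ Suc m) f z / (z - lam)) k))\<^sup>2 / rising (Suc (Suc m)) k)"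
proof -
  define F where "F = (\<lambda>z. (deriv ^^ Suc m) f z / (z - lam))"
  have nz: "z \<noteq> lam" if "z \<in> ball 0 1" for z using that lam by auto
  have F: "F holomorphic_on ball 0 1"
    unfolding F_def using nz by (intro holomorphic_on_divide holomorphic_higher_deriv f holomorphic_intros) auto
  have w: "fact k * fact (Suc m) / fact (k + Suc m + 1) = fact (Suc m) * (1 / rising (Suc (Suc m)) k)" for k
    by (simp only: rising_eq_fact) simp
  have "(\<integral>\<^sup>+ z \<in> unit_disc. ennreal (cmod ((deriv ^^ Suc m) f z) ^ 2 * ((1 - cmod z ^ 2) / cmod (z - lam) ^ 2)
                 * (1 - cmod z ^ 2) ^ (Suc m - 1) / pi) \<partial>lborel)
      = (\<integral>\<^sup>+ z \<in> ball 0 1. ennreal ((1 - (cmod z)\<^sup>2) ^ Suc m / pi * (cmod (F z))\<^sup>2) \<partial>lborel)"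
    unfolding unit_disc_def F_def
    by (intro nn_integral_cong) (auto simp: norm_divide power_divide mult_ac split: split_indicator)
  also have "\<dots> = (\<Sum>k. ennreal ((cmod (taylor_coeff F k))\<^sup>2 * (fact k * fact (Suc m) / fact (k + Suc m + 1))))"
    by (rule nn_integral_power_series_disc[OF F taylor_coeff_sums[OF F]])
  finally have "D_lambda lam (Suc m) f = ennreal (1 / (fact (Suc m) * fact (Suc m - 1)))
      * (\<Sum>k. ennreal ((cmod (taylor_coeff F k))\<^sup>2 * (fact k * fact (Suc m) / fact (k + Suc m + 1))))"
    unfolding D_lambda_def by (simp only:)
  then have "D_lambda lam (Suc m) f < \<infinity> \<longleftrightarrow>
      (\<Sum>k. ennreal ((cmod (taylor_coeff F k))\<^sup>2 * (fact k * fact (Suc m) / fact (k + Suc m + 1)))) < \<infinity>"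
  proof -
    have "ennreal c * X < \<infinity> \<longleftrightarrow> X < \<infinity>" if "c > 0" for c X
      using that by (auto simp: ennreal_mult_less_top ennreal_eq_0_iff)
    moreover have "(1 / (fact (Suc m) * fact (Suc m - 1)) :: real) > 0" by (intro divide_pos_pos mult_pos_pos) (rule zero_less_one fact_gt_zero)+
    ultimately show ?thesis using \<open>D_lambda lam (Suc m) f = _\<close> by (simp only:)
  qed
  also have "\<dots> \<longleftrightarrow> summable (\<lambda>k. (cmod (taylor_coeff F k))\<^sup>2 * (fact k * fact (Suc m) / fact (k + Suc m + 1)))"
    by (rule suminf_ennreal_finite_iff) simp
  also have "\<dots> \<longleftrightarrow> summable (\<lambda>k. fact (Suc m) * ((cmod (taylor_coeff F k))\<^sup>2 / rising (Suc (Suc m)) k))"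
    unfolding w by (simp add: mult_ac del: fact_Suc)
  also have "\<dots> \<longleftrightarrow> summable (\<lambda>k. (cmod (taylor_coeff F k))\<^sup>2 / rising (Suc (Suc m)) k)"
    by (subst summable_cmult_iff) simp
  finally show ?thesis unfolding F_def .
qed

text \<open>Both sides are conditions on partial sums built from the twisted coefficients
  \<open>A\<close>, and \<open>summable_rising_partial_sums_iff\<close> equates them. The number
  \<open>al\<close> is the radial limit of \<open>f\<close> at \<open>lam\<close>.\<close>

theorem H_lambda_iff:
  assumes lam: "cmod lam = 1"
  shows "f \<in> H_lambda lam (Suc m) \<longleftrightarrow> f \<in> Hol_disc \<and> (\<exists>al. (\<lambda>z. (f z - al) / (z - lam)) \<in> H_sigma m)"
proof (cases "f \<in> Hol_disc")
  case True
  then have f: "f holomorphic_on ball 0 1" by (simp add: Hol_disc_iff)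
  define A where "A k = taylor_coeff f k * lam ^ k" for k
  have nz: "z \<noteq> lam" if "z \<in> ball 0 1" for z using that lam by auto
  have df: "(deriv ^^ Suc m) f holomorphic_on ball 0 1" by (intro holomorphic_higher_deriv f) auto
  have 1: "cmod (taylor_coeff (\<lambda>z. (deriv ^^ Suc m) f z / (z - lam)) k)
      = cmod (\<Sum>i\<le>k. of_real (rising (Suc m) i) * A (i + Suc m))" for k
  proof -
    have "(\<Sum>i\<le>k. of_real (rising (Suc m) i) * A (i + Suc m))
        = lam ^ Suc m * (\<Sum>i\<le>k. taylor_coeff ((deriv ^^ Suc m) f) i * lam ^ i)"
      unfolding sum_distrib_left taylor_coeff_higher_deriv[OF f] A_def
      by (intro sum.cong refl) (simp only: power_add mult_ac)
    then show ?thesis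
      by (simp only: cmod_taylor_coeff_divide_linear[OF df lam] norm_mult norm_power lam) simp
  qed
  have 2: "cmod (taylor_coeff (\<lambda>z. (f z - al) / (z - lam)) k) = cmod (al - (\<Sum>i\<le>k. A i))" for al k
  proof -
    have fa: "(\<lambda>z. f z - al) holomorphic_on ball 0 1" by (intro holomorphic_intros f)
    have "(\<Sum>i\<le>k. (taylor_coeff f i - (if i = 0 then al else 0)) * lam ^ i) = (\<Sum>i\<le>k. A i - (if i = 0 then al else 0))"
      by (intro sum.cong refl) (auto simp: A_def left_diff_distrib)
    also have "\<dots> = (\<Sum>i\<le>k. A i) - al" by (simp add: sum_subtractf)
    finally show ?thesis
      by (simp only: cmod_taylor_coeff_divide_linear[OF fa lam] taylor_coeff_diff_const[OF f] norm_minus_commute)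
  qed
  have hol: "(\<lambda>z. (f z - al) / (z - lam)) holomorphic_on ball 0 1" for al
    using nz by (intro holomorphic_intros f) auto
  show ?thesis using True
    by (simp only: H_lambda_def mem_Collect_eq D_lambda_finite_iff[OF f lam] 1 summable_rising_partial_sums_iff
        H_sigma_iff 2 hol simp_thms)
qed (simp add: H_lambda_def)

lemma H_lambda_eq:
  assumes lam: "cmod lam = 1" and f: "f \<in> H_lambda lam (Suc m)"
  obtains al g where "g \<in> H_sigma m" "\<And>z. cmod z < 1 \<Longrightarrow> f z = al + (z - lam) * g z"
proof -
  obtain al where al: "(\<lambda>z. (f z - al) / (z - lam)) \<in> H_sigma m"
    using f by (auto simp: H_lambda_iff[OF lam])
  have "f z = al + (z - lam) * ((f z - al) / (z - lam))" if "cmod z < 1" for z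
  proof -
    have "z \<noteq> lam" using that lam by auto
    then show ?thesis by simp
  qed
  with al that show ?thesis by blast
qed

lemma H_lambdaI:
  assumes lam: "cmod lam = 1" and g: "g \<in> H_sigma m" and eq: "\<And>z. cmod z < 1 \<Longrightarrow> f z = al + (z - lam) * g z"
  shows "f \<in> H_lambda lam (Suc m)"
proof -
  have gh: "g holomorphic_on ball 0 1" using g by (simp add: H_sigma_iff)
  have "f \<in> Hol_disc" unfolding Hol_disc_iff
    by (rule holomorphic_transform[of "\<lambda>z. al + (z - lam) * g z"]) (auto intro!: holomorphic_intros gh simp: eq)
  moreover have "(\<lambda>z. (f z - al) / (z - lam)) \<in> H_sigma m"
  proof (rule H_sigma_cong[OF g])
    fix z :: complex assume z: "cmod z < 1"
    then have "z \<noteq> lam" using lam by auto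
    then show "g z = (f z - al) / (z - lam)" using eq[OF z] by simp
  qed
  ultimately show ?thesis by (auto simp: H_lambda_iff[OF lam])
qed

section \<open>Multipliers of \<open>H_lambda\<close>\<close>

lemma Mult_H_lambda:
  assumes lam: "cmod lam = 1"
  shows "Mult (H_lambda lam (Suc m)) = H_lambda lam (Suc m) \<inter> Mult (H_sigma m)"
proof (intro equalityI subsetI)
  fix p assume p: "p \<in> Mult (H_lambda lam (Suc m))"
  then have pmult: "\<And>f. f \<in> H_lambda lam (Suc m) \<Longrightarrow> (\<lambda>z. p z * f z) \<in> H_lambda lam (Suc m)"
    and hol: "p \<in> Hol_disc" by (auto simp: Mult_def)
  have zero: "(\<lambda>z. 0) \<in> H_sigma m"
    by (auto simp: H_sigma_iff taylor_coeff_def)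
  \<comment> \<open>The decomposition \<open>1 + (z - lam) * 0\<close> puts the constant 1 into the
    space, so every multiplier lies in the space too.\<close>
  have "(\<lambda>z. 1) \<in> H_lambda lam (Suc m)"
    by (rule H_lambdaI[OF lam zero, of _ 1]) simp
  from pmult[OF this] have pH: "p \<in> H_lambda lam (Suc m)" by simp
  obtain c q where q: "q \<in> H_sigma m" "\<And>z. cmod z < 1 \<Longrightarrow> p z = c + (z - lam) * q z"
    using H_lambda_eq[OF lam pH] by blast
  have ev: "eventually (\<lambda>r::real. 0 < r \<and> r < 1) (at_left 1)"
    using eventually_at_left_real[of 0 1] by simp
  have nr: "cmod (of_real r * lam) < 1" if "0 < r \<and> r < 1" for r
    using that lam by (simp add: norm_mult)
  \<comment> \<open>The constant of a decomposition is the radial limit at \<open>lam\<close>, hence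
    is determined by the function.\<close>
  have rad: "((\<lambda>r. F (of_real r * lam)) \<longlongrightarrow> al) (at_left 1)"
    if "h \<in> H_sigma m" "\<And>z. cmod z < 1 \<Longrightarrow> F z = al + (z - lam) * h z" for F h al
  proof -
    have "((\<lambda>r. al + (of_real r * lam - lam) * h (of_real r * lam)) \<longlongrightarrow> al + 0) (at_left 1)"
      by (intro tendsto_intros H_sigma_radial_limit[OF that(1) lam])
    moreover have "\<forall>\<^sub>F r in at_left 1. al + (of_real r * lam - lam) * h (of_real r * lam) = F (of_real r * lam)"
      using ev by eventually_elim (use that(2)[OF nr] in simp)
    ultimately show ?thesis by (simp add: tendsto_cong)
  qed
  have "(\<lambda>z. p z * g z) \<in> H_sigma m" if g: "g \<in> H_sigma m" for g
  proof -
    have "(\<lambda>z. (z - lam) * g z) \<in> H_lambda lam (Suc m)"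
      by (rule H_lambdaI[OF lam g, of _ 0]) simp
    from pmult[OF this] obtain al h where h: "h \<in> H_sigma m"
      and eq: "\<And>z. cmod z < 1 \<Longrightarrow> p z * ((z - lam) * g z) = al + (z - lam) * h z"
      using H_lambda_eq[OF lam] by blast
    \<comment> \<open>The radial limit of the product is computed twice: from its factors, as
      \<open>c * 0\<close>, and from its decomposition, as \<open>al\<close>. So \<open>al\<close>
      vanishes and \<open>z - lam\<close> can be cancelled.\<close>
    have "((\<lambda>r. p (of_real r * lam) * ((of_real r * lam - lam) * g (of_real r * lam))) \<longlongrightarrow> c * 0) (at_left 1)"
      by (intro tendsto_mult rad[OF q] H_sigma_radial_limit[OF g lam])
    moreover have "((\<lambda>r. p (of_real r * lam) * ((of_real r * lam - lam) * g (of_real r * lam))) \<longlongrightarrow> al) (at_left 1)"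
      using rad[OF h eq] .
    ultimately have "al = c * 0" by (intro tendsto_unique[of "at_left (1::real)"]) auto
    then have "h z = p z * g z" if "cmod z < 1" for z
    proof -
      have "z - lam \<noteq> 0" using that lam by auto
      moreover have "(z - lam) * (p z * g z) = (z - lam) * h z"
        using eq[OF that] \<open>al = c * 0\<close> by (simp add: mult_ac)
      ultimately show ?thesis by simp
    qed
    from H_sigma_cong[OF h this] show ?thesis .
  qed
  with pH hol show "p \<in> H_lambda lam (Suc m) \<inter> Mult (H_sigma m)" by (auto simp: Mult_def)
next
  fix p assume "p \<in> H_lambda lam (Suc m) \<inter> Mult (H_sigma m)"
  then have pH: "p \<in> H_lambda lam (Suc m)" and hol: "p \<in> Hol_disc"
    and pm: "\<And>g. g \<in> H_sigma m \<Longrightarrow> (\<lambda>z. p z * g z) \<in> H_sigma m" by (auto simp: Mult_def)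
  obtain c q where q: "q \<in> H_sigma m" "\<And>z. cmod z < 1 \<Longrightarrow> p z = c + (z - lam) * q z"
    using H_lambda_eq[OF lam pH] by blast
  have "(\<lambda>z. p z * f z) \<in> H_lambda lam (Suc m)" if f: "f \<in> H_lambda lam (Suc m)" for f
  proof -
    obtain al g where g: "g \<in> H_sigma m" "\<And>z. cmod z < 1 \<Longrightarrow> f z = al + (z - lam) * g z"
      using H_lambda_eq[OF lam f] by blast
    show ?thesis
    proof (rule H_lambdaI[OF lam])
      \<comment> \<open>Inserting \<open>p z = c + (z - lam) * q z\<close> into
        \<open>al * p z + (z - lam) * (p z * g z)\<close> splits off the constant
        \<open>al * c\<close> and leaves this cofactor of \<open>z - lam\<close>; the multiplier
        property puts \<open>p z * g z\<close> into \<open>H_sigma m\<close>.\<close>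
      show "(\<lambda>z. al * q z + p z * g z) \<in> H_sigma m"
        by (intro H_sigma_add H_sigma_cmult pm q(1) g(1))
      show "p z * f z = al * c + (z - lam) * (al * q z + p z * g z)" if "cmod z < 1" for z
      proof -
        have "p z * f z = al * p z + (z - lam) * (p z * g z)" by (simp add: g(2)[OF that] algebra_simps)
        also have "al * p z = al * c + (z - lam) * (al * q z)" by (simp add: q(2)[OF that] algebra_simps)
        finally show ?thesis by (simp add: algebra_simps)
      qed
    qed
  qed
  with hol show "p \<in> Mult (H_lambda lam (Suc m))" by (auto simp: Mult_def)
qed

theorem theorem3p5:
  fixes n :: nat and lam :: complex
  assumes "n \<ge> 1" and "cmod lam = 1"
  shows "Mult (H_lambda lam n) = H_lambda lam n \<inter> Mult (H_sigma (n - 1))"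
  using Mult_H_lambda[OF assms(2), of "n - 1"] assms(1) by simp

end
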